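(* Let $X\subseteq\mathbb{R}^n$ be a convex compact set with diameter $D_X$, and let $f(x)=\mathbb{E}_\xi[F(x,\xi)]$ be a convex function on $X$ such that for some $M>0$, $f(y)\le f(x)+\langle f'(x),y-x\rangle+M\|x-y\|$ for all $x,y\in X$, where $f'(x)\in\partial f(x)$. Assume that the outer iteration limit $N\ge1$ is given and that the parameters of the non-smooth CALSGD algorithm (see context) are set to $$\beta_k=\frac{\sqrt{N(\sigma^2+M^2)}}{D_X},\quad\gamma_k=\frac1k,\quad\eta_k=\frac{D_X\sqrt{\sigma^2+M^2}}{\sqrt N},\quad k\ge1.$$ Under the assumptions on the stochastic first-order oracle (unbiased stochastic subgradients with variance at most $\sigma^2$), $$\mathbb{E}[f(y_N)-f(x^* )]\le\frac{5D_X\sqrt{\sigma^2+M^2}}{2\sqrt N},\qquad\forall N\ge1,$$ where $x^*$ is a minimizer of $f$ over $X$. As a consequence, the total number of calls to the SFO oracle and to the $\mathrm{LOsep}_X$ oracle performed by this algorithm for finding a stochastic $\epsilon$-solution of $\min_{x\in X}f(x)$ can be bounded, respectively, by $$\mathcal{O}\left\{\frac{(\sigma^2+M^2)D_X^2}{\epsilon^2}\right\}$$ and, for $\Lambda\in(0,1)$, by $$\mathcal{O}\left\{\log\left(\frac{(\sigma^4+M^4)D_X^4}{\Lambda\epsilon^4}\right)+\frac{(\sigma^4+M^4)D_X^4}{\epsilon^4}\right\}\quad\text{with probability }1-\Lambda.$$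
   Context: $\|\cdot\|$ is the norm associated with the inner product of $\mathbb{R}^n$, $\|\cdot\|_*$ its conjugate norm, $D_X=\max_{x,y\in X}\|x-y\|$, $\partial f$ is the subdifferential. A stochastic $\epsilon$-solution is a (random) $\bar x\in X$ with $\mathbb{E}[f(\bar x)-f(x^* )]\le\epsilon$. Stochastic first-order (SFO) oracle: for a query point $z_k\in X$ it outputs a stochastic subgradient $F'(z_k,\xi_k)$ with $\mathbb{E}[F'(z_k,\xi_k)]=f'(z_k)\in\partial f(z_k)$ and $\mathbb{E}[\|F'(z_k,\xi_k)-f'(z_k)\|_*^2]\le\sigma^2$; the samples $\xi_k$ are independent of each other and of all earlier iterates. Non-smooth CALSGD algorithm (batch size 1). Input: $x_0\in X$, iteration limit $N$, $\alpha\ge1$, parameters $\beta_k>0$, $\gamma_k\in[0,1]$, $\eta_k\ge0$. Set $y_0=x_0$. For $k=1,\dots,N$: $z_k=(1-\gamma_k)y_{k-1}+\gamma_kx_{k-1}$; $g_k=F'(z_k,\xi_k)$; $x_k=\mathrm{LCG}(g_k,\beta_k,x_{k-1},\alpha,\eta_k)$; $y_k=(1-\gamma_k)y_{k-1}+\gamma_kx_k$. Output $y_N$. Here $\mathrm{LCG}(g,\beta,x,\alpha,\eta)$ is the output of the LCG procedure below applied to $\phi(u)=\langle g,u\rangle+\frac\beta2\|u-x\|^2$ from $u_1=x$; thus $x_k$ satisfies $\langle g_k+\beta_k(x_k-x_{k-1}),x_k-u\rangle\le\eta_k$ for all $u\in X$. Weak separation oracle $\mathrm{LOsep}_X(c,x,\Phi,\alpha)$: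 given $c\in\mathbb{R}^n$, $x\in X$, $\Phi>0$, $\alpha\ge1$, it returns a vertex $y\in X$ such that either (1) $c^T(x-y)>\Phi/\alpha$, or (2) $y\in\operatorname{argmax}_{z\in X}c^T(x-z)$ and $c^T(x-y)\le\Phi$. LCG procedure. Input: smooth convex $\phi$, $u_1\in X$, $\alpha\ge1$, $\eta$. Set $\Phi_0\leftarrow\max_{u\in X}\nabla\phi(u_1)^T(u_1-u)$. For $t=1,2,\dots$: let $v_t\leftarrow\mathrm{LOsep}_X(\nabla\phi(u_t),u_t,\Phi_{t-1},\alpha)$. If it is not the case that $\nabla\phi(u_t)^T(u_t-v_t)>\Phi_{t-1}/\alpha$, then: if $\Phi_{t-1}=\eta$, stop and return $u_t$; otherwise $\Phi_t\leftarrow\max\{\Phi_{t-1}/2,\eta\}$. (If $\nabla\phi(u_t)^T(u_t-v_t)>\Phi_{t-1}/\alpha$, then $\Phi_t\leftarrow\Phi_{t-1}$.) Then choose $\lambda_t\in\operatorname{argmin}_{\lambda\in[0,1]}\phi((1-\lambda)u_t+\lambda v_t)$ and set $u_{t+1}\leftarrow(1-\lambda_t)u_t+\lambda_tv_t$.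
   Formalization: The LOsep bound fails for α>1 if Φ_0 is the initial gap and this is below η; it is proved for Φ_0=max{gap,η} (any α), or for Φ_0=gap when α=1. O{.} is read as ε→0 (threshold depends on the problem), its constant may depend on α and n. *)

theory Defs
  imports "HOL-Probability.Probability"
begin

definition dual_norm :: "'a::real_inner \<Rightarrow> real" where
  "dual_norm c = (SUP u\<in>cball 0 1. c \<bullet> u)"

text \<open>Subgradients are tested on \<open>X\<close> only, since the objective is a function on \<open>X\<close>.\<close>

definition subdifferential :: "'a::real_inner set \<Rightarrow> ('a \<Rightarrow> real) \<Rightarrow> 'a \<Rightarrow> 'a set" where
  "subdifferential X f x = {g. \<forall>y\<in>X. f y \<ge> f x + g \<bullet> (y - x)}"

definition grad :: "('a::real_inner \<Rightarrow> real) \<Rightarrow> 'a \<Rightarrow> 'a" where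
  "grad \<phi> u = (THE D. GDERIV \<phi> u :> D)"

text \<open>
  \<open>P\<close> is the law of the random element in \<open>f x = E[F(x, \<xi>)]\<close>. The diameter is
  required to be positive because the stepsize parameter divides by it.
\<close>

definition nonsmooth_problem ::
  "'a::euclidean_space set \<Rightarrow> 's measure \<Rightarrow> ('a \<Rightarrow> 's \<Rightarrow> real) \<Rightarrow> ('a \<Rightarrow> real) \<Rightarrow> ('a \<Rightarrow> 'a) \<Rightarrow> real \<Rightarrow> bool"
where
  "nonsmooth_problem X P F f f' M \<longleftrightarrow>
     convex X \<and> compact X \<and> 0 < diameter X \<and>
     prob_space P \<and> (\<forall>x\<in>X. integrable P (F x) \<and> f x = (\<integral>s. F x s \<partial>P)) \<and>
     convex_on X f \<and> 0 < M \<and>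
     (\<forall>x\<in>X. f' x \<in> subdifferential X f x) \<and>
     (\<forall>x\<in>X. \<forall>y\<in>X. f y \<le> f x + f' x \<bullet> (y - x) + M * norm (x - y))"

text \<open>
  Unbiasedness and the variance bound are stated for deterministic query points. For the
  random query points of the algorithm they hold conditionally on the past, because each
  sample is independent of the past. The samples need not be identically distributed.
\<close>

definition sfo_oracle ::
  "'w measure \<Rightarrow> 's measure \<Rightarrow> nat \<Rightarrow> (nat \<Rightarrow> 'w \<Rightarrow> 's) \<Rightarrow> 'a::euclidean_space set \<Rightarrow>
   ('a \<Rightarrow> 's \<Rightarrow> 'a) \<Rightarrow> ('a \<Rightarrow> 'a) \<Rightarrow> real \<Rightarrow> bool"
where
  "sfo_oracle \<Omega> P N \<xi> X F' f' \<sigma> \<longleftrightarrow>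
     (\<lambda>(z, s). F' z s) \<in> borel_measurable (restrict_space borel X \<Otimes>\<^sub>M P) \<and>
     (\<forall>k\<in>{1..N}. \<xi> k \<in> measurable \<Omega> P \<and>
       (\<forall>z\<in>X.
          integrable \<Omega> (\<lambda>\<omega>. F' z (\<xi> k \<omega>)) \<and>
          (\<integral>\<omega>. F' z (\<xi> k \<omega>) \<partial>\<Omega>) = f' z \<and>
          integrable \<Omega> (\<lambda>\<omega>. (dual_norm (F' z (\<xi> k \<omega>) - f' z))\<^sup>2) \<and>
          (\<integral>\<omega>. (dual_norm (F' z (\<xi> k \<omega>) - f' z))\<^sup>2 \<partial>\<Omega>) \<le> \<sigma>\<^sup>2))"

text \<open>\<open>y\<close> is an admissible answer of the weak separation oracle.\<close>

definition losep :: "'a::euclidean_space set \<Rightarrow> 'a \<Rightarrow> 'a \<Rightarrow> real \<Rightarrow> real \<Rightarrow> 'a \<Rightarrow> bool" where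
  "losep X c x \<Phi> \<alpha> y \<longleftrightarrow> y extreme_point_of X \<and>
     (c \<bullet> (x - y) > \<Phi> / \<alpha> \<or>
      is_arg_max (\<lambda>z. c \<bullet> (x - z)) (\<lambda>z. z \<in> X) y \<and> c \<bullet> (x - y) \<le> \<Phi>)"

text \<open>
  \<open>lcg init X \<phi> u1 \<alpha> \<eta> w T\<close>: some execution of the LCG procedure makes exactly \<open>T\<close>
  oracle calls and returns \<open>w\<close>. Oracle answers and line searches are arbitrary admissible
  ones, possibly depending on the history. \<open>T = \<infinity>\<close> stands for an execution that never
  stops; then nothing is said about \<open>w\<close>.

  The initial bound is computed by \<open>init\<close> from the initial gap
  \<open>max\<^bsub>z\<in>X\<^esub> \<langle>\<nabla>\<phi>(u1), u1 - z\<rangle>\<close> and \<open>\<eta>\<close>. With \<open>init = (\<lambda>G \<eta>. G)\<close> it is the gap itself;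
  with \<open>init = max\<close> it is additionally kept from falling below \<open>\<eta>\<close>, like all later bounds.
  The two agree unless the gap at \<open>u1\<close> is already below the target accuracy \<open>\<eta>\<close>.
  In that case, for \<open>\<alpha> > 1\<close>, the unfloored procedure works at an accuracy much finer than
  \<open>\<eta>\<close> before it may stop, and its number of calls is not controlled by \<open>\<eta>\<close>.
\<close>

definition lcg ::
  "(real \<Rightarrow> real \<Rightarrow> real) \<Rightarrow> 'a::euclidean_space set \<Rightarrow> ('a \<Rightarrow> real) \<Rightarrow> 'a \<Rightarrow> real \<Rightarrow> real \<Rightarrow> 'a \<Rightarrow> enat \<Rightarrow> bool"
where
  "lcg init X \<phi> u1 \<alpha> \<eta> w T \<longleftrightarrow>
     (\<exists>(u :: nat \<Rightarrow> 'a) (v :: nat \<Rightarrow> 'a) (\<Phi> :: nat \<Rightarrow> real) (l :: nat \<Rightarrow> real).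
        1 \<le> T \<and> u 1 = u1 \<and>
        \<Phi> 0 = init (SUP z\<in>X. grad \<phi> u1 \<bullet> (u1 - z)) \<eta> \<and>
        (\<forall>t\<ge>1. enat t \<le> T \<longrightarrow> losep X (grad \<phi> (u t)) (u t) (\<Phi> (t - 1)) \<alpha> (v t)) \<and>
        (\<forall>t\<ge>1. enat t < T \<longrightarrow>
           (if grad \<phi> (u t) \<bullet> (u t - v t) > \<Phi> (t - 1) / \<alpha>
            then \<Phi> t = \<Phi> (t - 1)
            else \<Phi> (t - 1) \<noteq> \<eta> \<and> \<Phi> t = max (\<Phi> (t - 1) / 2) \<eta>) \<and>
           is_arg_min (\<lambda>s. \<phi> ((1 - s) *\<^sub>R u t + s *\<^sub>R v t)) (\<lambda>s. s \<in> {0..1}) (l t) \<and>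
           u (Suc t) = (1 - l t) *\<^sub>R u t + l t *\<^sub>R v t) \<and>
        (\<forall>t. T = enat t \<longrightarrow>
           \<not> grad \<phi> (u t) \<bullet> (u t - v t) > \<Phi> (t - 1) / \<alpha> \<and> \<Phi> (t - 1) = \<eta> \<and> w = u t))"

text \<open>
  \<open>T k\<close> is the number of separation oracle calls in the \<open>k\<close>-th outer iteration. Each outer
  iteration calls the stochastic first-order oracle once, hence \<open>N\<close> calls in total.
  The sample \<open>\<xi> k\<close> is independent of all earlier samples and iterates; \<open>x\<^sub>0\<close> is
  deterministic, and the \<open>y\<close> and \<open>z\<close> iterates are functions of the \<open>x\<close> iterates.
  (\<open>indep_var\<close> would force both random elements into the same type.)
\<close>

definition calsgd_run ::
  "(real \<Rightarrow> real \<Rightarrow> real) \<Rightarrow> 'w measure \<Rightarrow> 's measure \<Rightarrow> (nat \<Rightarrow> 'w \<Rightarrow> 's) \<Rightarrow> 'a::euclidean_space set \<Rightarrow>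
   ('a \<Rightarrow> 's \<Rightarrow> 'a) \<Rightarrow> real \<Rightarrow> nat \<Rightarrow> (nat \<Rightarrow> real) \<Rightarrow> (nat \<Rightarrow> real) \<Rightarrow> (nat \<Rightarrow> real) \<Rightarrow> 'a \<Rightarrow>
   (nat \<Rightarrow> 'w \<Rightarrow> 'a) \<Rightarrow> (nat \<Rightarrow> 'w \<Rightarrow> 'a) \<Rightarrow> (nat \<Rightarrow> 'w \<Rightarrow> 'a) \<Rightarrow> (nat \<Rightarrow> 'w \<Rightarrow> enat) \<Rightarrow> bool"
where
  "calsgd_run init \<Omega> P \<xi> X F' \<alpha> N \<beta> \<gamma> \<eta> x0 x y z T \<longleftrightarrow>
     prob_space \<Omega> \<and> x0 \<in> X \<and> (\<forall>\<omega>\<in>space \<Omega>. x 0 \<omega> = x0 \<and> y 0 \<omega> = x0) \<and>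
     (\<forall>k\<in>{1..N}. \<forall>\<omega>\<in>space \<Omega>.
        z k \<omega> = (1 - \<gamma> k) *\<^sub>R y (k - 1) \<omega> + \<gamma> k *\<^sub>R x (k - 1) \<omega> \<and>
        lcg init X
          (\<lambda>u. F' (z k \<omega>) (\<xi> k \<omega>) \<bullet> u + \<beta> k / 2 * (norm (u - x (k - 1) \<omega>))\<^sup>2)
          (x (k - 1) \<omega>) \<alpha> (\<eta> k) (x k \<omega>) (T k \<omega>) \<and>
        y k \<omega> = (1 - \<gamma> k) *\<^sub>R y (k - 1) \<omega> + \<gamma> k *\<^sub>R x k \<omega>) \<and>
     (\<forall>k\<in>{1..N}.
        x k \<in> borel_measurable \<Omega> \<and> T k \<in> measurable \<Omega> (count_space UNIV) \<and>
        prob_space.indep_set \<Omega>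
          (sets (vimage_algebra (space \<Omega>)
             (\<lambda>\<omega>. \<lambda>i\<in>{1..<k}. (x i \<omega>, \<xi> i \<omega>)) (Pi\<^sub>M {1..<k} (\<lambda>_. borel \<Otimes>\<^sub>M P))))
          (sets (vimage_algebra (space \<Omega>) (\<xi> k) P)))"

definition stochastic_solution ::
  "'w measure \<Rightarrow> 'a::euclidean_space set \<Rightarrow> ('a \<Rightarrow> real) \<Rightarrow> 'a \<Rightarrow> real \<Rightarrow> ('w \<Rightarrow> 'a) \<Rightarrow> bool"
where
  "stochastic_solution \<Omega> X f xs \<epsilon> Y \<longleftrightarrow>
     Y \<in> borel_measurable \<Omega> \<and> (\<forall>\<omega>\<in>space \<Omega>. Y \<omega> \<in> X) \<and>
     integrable \<Omega> (\<lambda>\<omega>. f (Y \<omega>) - f xs) \<and> (\<integral>\<omega>. f (Y \<omega>) - f xs \<partial>\<Omega>) \<le> \<epsilon>"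

definition nonsmooth_calsgd ::
  "(real \<Rightarrow> real \<Rightarrow> real) \<Rightarrow> 'w measure \<Rightarrow> 's measure \<Rightarrow> (nat \<Rightarrow> 'w \<Rightarrow> 's) \<Rightarrow> 'a::euclidean_space set \<Rightarrow>
   ('a \<Rightarrow> 's \<Rightarrow> 'a) \<Rightarrow> ('a \<Rightarrow> 'a) \<Rightarrow> real \<Rightarrow> real \<Rightarrow> real \<Rightarrow> nat \<Rightarrow> 'a \<Rightarrow>
   (nat \<Rightarrow> 'w \<Rightarrow> 'a) \<Rightarrow> (nat \<Rightarrow> 'w \<Rightarrow> 'a) \<Rightarrow> (nat \<Rightarrow> 'w \<Rightarrow> 'a) \<Rightarrow> (nat \<Rightarrow> 'w \<Rightarrow> enat) \<Rightarrow> bool"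
where
  "nonsmooth_calsgd init \<Omega> P \<xi> X F' f' M \<sigma> \<alpha> N x0 x y z T \<longleftrightarrow>
     sfo_oracle \<Omega> P N \<xi> X F' f' \<sigma> \<and>
     calsgd_run init \<Omega> P \<xi> X F' \<alpha> N
       (\<lambda>k. sqrt (real N * (\<sigma>\<^sup>2 + M\<^sup>2)) / diameter X)
       (\<lambda>k. 1 / real k)
       (\<lambda>k. diameter X * sqrt (\<sigma>\<^sup>2 + M\<^sup>2) / sqrt (real N))
       x0 x y z T"

end

theory Submission
  imports Defs
begin

text \<open>
  Each LCG call is charged to a potential in the primal gap \<open>h\<close> and the current bound \<open>\<Phi>\<close>
  that drops by at least one per oracle call: exact line search decreases \<open>h\<close> by a fixed
  amount while \<open>\<Phi>\<close> is constant, and \<open>h \<le> 2 \<Phi>\<close> whenever \<open>\<Phi>\<close> has just been halved. Hence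
  every call stops, and after \<open>O(log(\<Phi>\<^sub>0/\<eta>) + \<beta> D\<^sup>2/\<eta>)\<close> steps if \<open>\<Phi>\<^sub>0 \<ge> \<eta>\<close>; here \<open>\<beta> D\<^sup>2/\<eta> = N\<close>.

  The rate is the usual telescoping estimate, in which the noise enters through its second
  moment and through \<open>\<langle>\<delta>\<^sub>k, u - x\<^sub>k\<^sub>-\<^sub>1\<rangle>\<close>, whose mean is zero because \<open>\<xi>\<^sub>k\<close> is independent of the past.

  For the total number of calls, \<open>\<Phi>\<^sub>0/\<eta>\<close> in iteration \<open>k\<close> is dominated by a weight with
  conditional mean at most \<open>A = 1 + V/\<eta> + \<surd>N\<close>, so the product of the weights has mean at most
  \<open>A ^ N\<close>. Applying Markov's inequality to the product, rather than to each factor, bounds the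
  sum of the logarithms by \<open>N ln A + ln(1/\<Lambda>) = O(N\<^sup>2) + ln(1/\<Lambda>)\<close> with probability \<open>1 - \<Lambda>\<close>.
\<close>

section \<open>Counting the calls of the LCG procedure\<close>

text \<open>Cauchy-Schwarz bounds the supremum and the normalised vector attains it, so the variance
  condition of the oracle can be read in the Euclidean norm throughout.\<close>

lemma dual_norm_eq_norm: "dual_norm c = norm (c :: 'a::real_inner)"
  unfolding dual_norm_def
proof (rule cSup_eq_maximum)
  show "norm c \<in> (\<lambda>u. c \<bullet> u) ` cball 0 1"
  proof (cases "c = 0")
    case False
    then have "c \<bullet> (c /\<^sub>R norm c) = norm c"
      by (simp add: dot_square_norm power2_eq_square)
    with False show ?thesis
      by (intro image_eqI[of _ _ "c /\<^sub>R norm c"]) auto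
  qed (auto intro!: image_eqI[of _ _ 0])
  show "y \<le> norm c" if y: "y \<in> (\<lambda>u. c \<bullet> u) ` cball 0 1" for y
  proof -
    obtain u where u: "norm u \<le> 1" "y = c \<bullet> u" using y by auto
    have "y \<le> norm c * norm u" using u norm_cauchy_schwarz by metis
    also have "\<dots> \<le> norm c * 1" using u by (intro mult_left_mono) auto
    finally show ?thesis by simp
  qed
qed

text \<open>Uniqueness of the Frechet derivative lets the definite description in
  \<open>grad\<close> be evaluated at any gradient that is exhibited.\<close>

lemma grad_eqI: "GDERIV \<phi> u :> D \<Longrightarrow> grad \<phi> u = D"
  unfolding grad_def
proof (rule the_equality)
  fix E assume "GDERIV \<phi> u :> D" "GDERIV \<phi> u :> E"
  then have "(\<lambda>h. h \<bullet> D) = (\<lambda>h. h \<bullet> E)"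
    unfolding gderiv_def by (rule has_derivative_unique)
  then have "h \<bullet> E = h \<bullet> D" for h by (metis (no_types))
  then show "E = D" using vector_eq_ldot by blast
qed

section \<open>The quadratic model minimised by LCG\<close>

definition prox :: "'a::real_inner \<Rightarrow> real \<Rightarrow> 'a \<Rightarrow> 'a \<Rightarrow> real" where
  "prox g \<beta> x = (\<lambda>u. g \<bullet> u + \<beta> / 2 * (norm (u - x))\<^sup>2)"

lemma grad_prox: "grad (prox g \<beta> x) u = g + \<beta> *\<^sub>R (u - x)"
  unfolding prox_def
  by (rule grad_eqI, unfold gderiv_def power2_norm_eq_inner)
     (auto intro!: derivative_eq_intros
       simp: fun_eq_iff algebra_simps inner_simps inner_commute)

text \<open>A quadratic equals its second-order expansion. Dropping the last term gives the
  convexity bound on the primal gap; keeping it gives the descent estimate for the line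
  search.\<close>

lemma prox_expand:
  "prox g \<beta> x p = prox g \<beta> x u + (g + \<beta> *\<^sub>R (u - x)) \<bullet> (p - u) + \<beta> / 2 * (norm (p - u))\<^sup>2"
  unfolding prox_def power2_norm_eq_inner
  by (simp add: algebra_simps inner_simps inner_commute)

text \<open>
  The first summand of \<open>lcg_potential\<close> pays for the remaining steps that decrease the
  objective at the current bound \<open>\<Phi>\<close> when \<open>h\<close> is the primal gap; the rest pays for
  everything that happens after the next halvings of \<open>\<Phi>\<close>, where \<open>h\<close> is at most twice the
  new bound.
\<close>

definition lcg_potential :: "real \<Rightarrow> real \<Rightarrow> real \<Rightarrow> real \<Rightarrow> real \<Rightarrow> real" where
  "lcg_potential \<alpha> B \<eta> h \<Phi> = h * (2 * \<alpha> / \<Phi> + 2 * \<alpha>\<^sup>2 * B / \<Phi>\<^sup>2) +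
     (if \<Phi> < \<eta> then 1 + 2 * \<alpha> + 2 * \<alpha>\<^sup>2 * B / \<eta>
      else (if \<Phi> = \<eta> then 0 else 4 * \<alpha> + 1 + 4 * \<alpha>\<^sup>2 * B / \<eta>) +
        (4 * \<alpha> + 1) * log 2 (\<Phi> / \<eta>) + 4 * \<alpha>\<^sup>2 * B * (2 / \<eta> - 2 / \<Phi>))"

section \<open>The charge of a single call to the potential\<close>

context
  fixes \<alpha> B \<eta> :: real
  assumes \<alpha>: "1 \<le> \<alpha>" and B: "0 < B" and \<eta>: "0 < \<eta>"
begin

lemma lcg_potential_nonneg:
  assumes "0 \<le> h" "0 < \<Phi>"
  shows "0 \<le> lcg_potential \<alpha> B \<eta> h \<Phi>"
proof (cases "\<Phi> < \<eta>")
  case True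
  then show ?thesis using assms \<alpha> B \<eta> by (simp add: lcg_potential_def)
next
  case False
  then have "2 / \<Phi> \<le> 2 / \<eta>" "0 \<le> log 2 (\<Phi> / \<eta>)"
    using assms \<eta> by (simp_all add: frac_le)
  then show ?thesis using False assms \<alpha> B \<eta>
    by (simp add: lcg_potential_def)
qed

text \<open>While \<open>\<Phi>\<close> is fixed, only the term in \<open>h\<close> moves. Its
  coefficient is the sum of the reciprocals of two guaranteed decreases of \<open>h\<close>, one for
  a short step and one for the full step, so in either case the decrease pays for one call.\<close>

lemma lcg_potential_descent:
  assumes "0 < \<Phi>" and gap: "\<Phi> / \<alpha> < gap"
    and h': "\<And>s. s \<in> {0..1} \<Longrightarrow> h' \<le> h - s * gap + B / 2 * s\<^sup>2"
  shows "lcg_potential \<alpha> B \<eta> h' \<Phi> + 1 \<le> lcg_potential \<alpha> B \<eta> h \<Phi>"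
proof -
  define q where "q = \<Phi> / \<alpha>"
  have q: "0 < q" "q < gap" using assms \<alpha> by (auto simp: q_def)
  define c where "c = 2 / q + 2 * B / q\<^sup>2"
  have c: "c = 2 * \<alpha> / \<Phi> + 2 * \<alpha>\<^sup>2 * B / \<Phi>\<^sup>2"
    using assms \<alpha> by (simp add: c_def q_def power_divide)
  have cpos: "0 < c" using q B by (simp add: c_def add_pos_pos)
  have "1 \<le> (h - h') * c"
  proof (cases "q \<le> B")
    case True
    \<comment> \<open>The step \<open>q / B\<close> minimises the upper bound once
      \<open>gap\<close> is replaced by the smaller \<open>q\<close>; it is admissible because
      \<open>q \<le> B\<close>.\<close>
    then have "h' \<le> h - q / B * gap + B / 2 * (q / B)\<^sup>2" using q B by (intro h') auto
    moreover have "q / B * q \<le> q / B * gap" using q B by (intro mult_left_mono) auto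
    moreover have "B / 2 * (q / B)\<^sup>2 = q\<^sup>2 / B / 2" "q / B * q = q\<^sup>2 / B" using B
      by (simp_all add: power2_eq_square)
    ultimately have "q\<^sup>2 / B / 2 \<le> h - h'" by linarith
    then have "q\<^sup>2 / B / 2 * c \<le> (h - h') * c" using cpos by (intro mult_right_mono) auto
    moreover have "q\<^sup>2 / B / 2 * c = q / B + 1"
      using q B by (simp add: c_def field_simps power2_eq_square)
    moreover have "0 < q / B" using q B by simp
    ultimately show ?thesis by linarith
  next
    case False
    \<comment> \<open>For \<open>B < q\<close> that minimiser exceeds 1, and the full step already
      gains \<open>q / 2\<close>.\<close>
    have "h' \<le> h - 1 * gap + B / 2 * 1\<^sup>2" by (intro h') auto
    then have "q / 2 \<le> h - h'" using False q by simp
    then have "q / 2 * c \<le> (h - h') * c" using cpos by (intro mult_right_mono) auto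
    moreover have "q / 2 * c = 1 + B / q"
      using q by (simp add: c_def field_simps power2_eq_square)
    moreover have "0 < B / q" using q B by simp
    ultimately show ?thesis by linarith
  qed
  then have "h' * c + 1 \<le> h * c" by (simp add: left_diff_distrib)
  then show ?thesis unfolding lcg_potential_def c[symmetric] by simp
qed

text \<open>The new gap is at most twice the new bound \<open>\<Psi>\<close>, so the renewed first
  summand costs at most \<open>4 * \<alpha> + 4 * \<alpha>\<^sup>2 * B / \<Psi>\<close>. A genuine
  halving lowers the logarithm by one and releases \<open>1 / \<Psi>\<close> in the reciprocal term,
  which covers this cost and the call itself. The one-time constants of the potential pay for the
  jump to \<open>\<eta>\<close> from below and for the last, truncated halving.\<close>

lemma lcg_potential_halve:
  assumes "0 \<le> h'" "h' \<le> h" "h \<le> \<Phi>" and \<Phi>: "0 < \<Phi>" "\<Phi> \<noteq> \<eta>"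
  shows "lcg_potential \<alpha> B \<eta> h' (max (\<Phi> / 2) \<eta>) + 1 \<le> lcg_potential \<alpha> B \<eta> h \<Phi>"
proof -
  define \<Psi> where "\<Psi> = max (\<Phi> / 2) \<eta>"
  define c where "c p = 2 * \<alpha> / p + 2 * \<alpha>\<^sup>2 * B / p\<^sup>2" for p
  have cpos: "0 \<le> c p" if "0 < p" for p using that \<alpha> B by (simp add: c_def)
  have cmul: "p * c p = 2 * \<alpha> + 2 * \<alpha>\<^sup>2 * B / p" if "0 < p" for p
    using that by (simp add: c_def field_simps power2_eq_square)
  have first: "0 \<le> h * c \<Phi>" using assms cpos by simp
  show ?thesis
  proof (cases "\<Phi> < \<eta>")
    case True
    then have *: "max (\<Phi> / 2) \<eta> = \<eta>" using \<eta> by simp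
    have "h' * c \<eta> \<le> \<eta> * c \<eta>" using assms True cpos[OF \<eta>] by (intro mult_right_mono) auto
    then show ?thesis using True first \<eta> cmul[OF \<eta>]
      unfolding * lcg_potential_def c_def[symmetric] by simp
  next
    case False
    have \<Psi>: "0 < \<Psi>" "h' \<le> 2 * \<Psi>" using assms \<eta> by (auto simp: \<Psi>_def)
    have "h' * c \<Psi> \<le> 2 * \<Psi> * c \<Psi>" using cpos \<Psi> by (intro mult_right_mono) auto
    then have hc: "h' * c \<Psi> \<le> 4 * \<alpha> + 4 * \<alpha>\<^sup>2 * B / \<Psi>"
      using cmul[OF \<Psi>(1)] by (simp add: mult.assoc)
    show ?thesis
    proof (cases "\<eta> < \<Phi> / 2")
      case True
      then have \<Psi>_eq: "\<Psi> = \<Phi> / 2" by (simp add: \<Psi>_def)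
      have "log 2 (\<Phi> / \<eta>) = log 2 (\<Phi> / 2 / \<eta>) + log 2 2"
        using \<Phi> \<eta> by (subst log_mult_pos[symmetric]) auto
      then have log: "log 2 (\<Phi> / \<eta>) = log 2 (\<Psi> / \<eta>) + 1" by (simp add: \<Psi>_eq)
      have r: "2 / \<eta> - 2 / \<Phi> = (2 / \<eta> - 2 / \<Psi>) + 1 / \<Psi>" using \<Phi> by (simp add: \<Psi>_eq)
      show ?thesis using True False hc first \<Phi>
        unfolding \<Psi>_def[symmetric] lcg_potential_def c_def[symmetric] log r
        by (simp add: \<Psi>_eq algebra_simps)
    next
      case F2: False
      \<comment> \<open>The halving is cut off at \<open>\<eta>\<close>. The logarithm may fall by
        less than one, so the constant reserved for \<open>\<Phi> \<noteq> \<eta>\<close> pays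
        instead.\<close>
      then have \<Psi>_eq: "\<Psi> = \<eta>" by (simp add: \<Psi>_def)
      have "2 / \<Phi> \<le> 2 / \<eta>" "0 \<le> log 2 (\<Phi> / \<eta>)"
        using False \<Phi> \<eta> by (simp_all add: frac_le)
      moreover define r where "r = 4 * \<alpha>\<^sup>2 * B * (2 / \<eta> - 2 / \<Phi>)"
      ultimately have "0 \<le> (4 * \<alpha> + 1) * log 2 (\<Phi> / \<eta>)" "0 \<le> r"
        using \<alpha> B by simp_all
      then show ?thesis using F2 False hc first \<Phi> \<eta>
        unfolding \<Psi>_def[symmetric] lcg_potential_def c_def[symmetric] r_def[symmetric]
        by (simp add: \<Psi>_eq)
    qed
  qed
qed

text \<open>With \<open>a = \<alpha>\<^sup>2 * B\<close>, the contributions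
  \<open>2 * a / \<Phi>\<close>, \<open>4 * a / \<eta>\<close> and
  \<open>8 * a / \<eta> - 8 * a / \<Phi>\<close> are majorised by 2, 4 and 8 times
  \<open>a / \<eta>\<close>, whence the 14.\<close>

lemma lcg_potential_le:
  assumes "h \<le> \<Phi>" "\<eta> \<le> \<Phi>"
  shows "lcg_potential \<alpha> B \<eta> h \<Phi>
    \<le> 6 * \<alpha> + 1 + (4 * \<alpha> + 1) * log 2 (\<Phi> / \<eta>) + 14 * \<alpha>\<^sup>2 * B / \<eta>"
proof -
  have \<Phi>: "0 < \<Phi>" using assms \<eta> by simp
  define a where "a = \<alpha>\<^sup>2 * B"
  have a: "0 < a" using \<alpha> B by (simp add: a_def)
  have "h * (2 * \<alpha> / \<Phi> + 2 * a / \<Phi>\<^sup>2) \<le> \<Phi> * (2 * \<alpha> / \<Phi> + 2 * a / \<Phi>\<^sup>2)"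
    using assms \<Phi> \<alpha> a by (intro mult_right_mono) auto
  also have "\<dots> = 2 * \<alpha> + 2 * (a / \<Phi>)" using \<Phi> by (simp add: field_simps power2_eq_square)
  finally have 1: "h * (2 * \<alpha> / \<Phi> + 2 * a / \<Phi>\<^sup>2) \<le> 2 * \<alpha> + 2 * (a / \<Phi>)" .
  have 2: "(if \<Phi> = \<eta> then 0 else 4 * \<alpha> + 1 + 4 * (a / \<eta>)) \<le> 4 * \<alpha> + 1 + 4 * (a / \<eta>)"
    using \<alpha> a \<eta> by simp
  have "0 < a / \<Phi>" "a / \<Phi> \<le> a / \<eta>" using a \<Phi> assms \<eta> by (simp_all add: frac_le)
  moreover have "4 * a * (2 / \<eta> - 2 / \<Phi>) = 8 * (a / \<eta>) - 8 * (a / \<Phi>)" by (simp add: field_simps)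
  ultimately have "h * (2 * \<alpha> / \<Phi> + 2 * a / \<Phi>\<^sup>2) +
      ((if \<Phi> = \<eta> then 0 else 4 * \<alpha> + 1 + 4 * (a / \<eta>)) + (4 * \<alpha> + 1) * log 2 (\<Phi> / \<eta>)
        + 4 * a * (2 / \<eta> - 2 / \<Phi>))
    \<le> 6 * \<alpha> + 1 + (4 * \<alpha> + 1) * log 2 (\<Phi> / \<eta>) + 14 * (a / \<eta>)"
    using 1 2 by linarith
  then show ?thesis using assms unfolding lcg_potential_def a_def
    by (simp add: mult.assoc split: if_split_asm)
qed

end

section \<open>Termination, accuracy and cost of an LCG execution\<close>

lemma continuous_on_prox: "continuous_on S (prox g \<beta> x)"
  unfolding prox_def by (intro continuous_intros)

text \<open>\<open>G0\<close> may be any bound on the initial gap, so that a noise-dependent one can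
  be inserted later. Accuracy and termination hold for both initial bounds. The explicit count needs
  the potential to start from a bound of at least \<open>\<eta>\<close>: the floor provides it at
  once, and for \<open>\<alpha> = 1\<close> an initial bound below \<open>\<eta>\<close> fails the
  first test and is raised to \<open>\<eta>\<close>.\<close>

lemma lcg_correct:
  fixes X :: "'a::euclidean_space set"
  assumes X: "convex X" "compact X" and x: "x \<in> X"
    and D: "\<And>a b. a \<in> X \<Longrightarrow> b \<in> X \<Longrightarrow> norm (a - b) \<le> D" "0 < D"
    and pos: "0 < \<beta>" "0 < \<eta>" "1 \<le> \<alpha>"
    and init: "init \<in> {\<lambda>G \<eta>. G, max}"
    and gap0: "\<And>z. z \<in> X \<Longrightarrow> g \<bullet> (x - z) \<le> G0"
    and run: "lcg init X (prox g \<beta> x) x \<alpha> \<eta> w T"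
  shows "w \<in> X"
    and "\<And>z. z \<in> X \<Longrightarrow> (g + \<beta> *\<^sub>R (w - x)) \<bullet> (w - z) \<le> \<eta>"
    and "T \<noteq> \<infinity>"
    and "init = max \<or> \<alpha> = 1 \<Longrightarrow> real (the_enat T)
      \<le> 6 * \<alpha> + 3 + (4 * \<alpha> + 1) * log 2 (1 + G0 / \<eta>) + 14 * \<alpha>\<^sup>2 * (\<beta> * D\<^sup>2) / \<eta>"
proof -
  let ?\<phi> = "prox g \<beta> x"
  define d where "d u = g + \<beta> *\<^sub>R (u - x)" for u
  define B where "B = \<beta> * D\<^sup>2"
  have B: "0 < B" using pos D by (simp add: B_def)
  obtain u v \<Phi> l where T1: "1 \<le> T" and u1: "u 1 = x"
    and \<Phi>0: "\<Phi> 0 = init (SUP z\<in>X. d x \<bullet> (x - z)) \<eta>"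
    and sep: "\<And>t. 1 \<le> t \<Longrightarrow> enat t \<le> T \<Longrightarrow> losep X (d (u t)) (u t) (\<Phi> (t - 1)) \<alpha> (v t)"
    and step: "\<And>t. 1 \<le> t \<Longrightarrow> enat t < T \<Longrightarrow>
           (if d (u t) \<bullet> (u t - v t) > \<Phi> (t - 1) / \<alpha>
            then \<Phi> t = \<Phi> (t - 1)
            else \<Phi> (t - 1) \<noteq> \<eta> \<and> \<Phi> t = max (\<Phi> (t - 1) / 2) \<eta>) \<and>
           is_arg_min (\<lambda>s. ?\<phi> ((1 - s) *\<^sub>R u t + s *\<^sub>R v t)) (\<lambda>s. s \<in> {0..1}) (l t) \<and>
           u (Suc t) = (1 - l t) *\<^sub>R u t + l t *\<^sub>R v t"
    and stop: "\<And>t. T = enat t \<Longrightarrow>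
           \<not> d (u t) \<bullet> (u t - v t) > \<Phi> (t - 1) / \<alpha> \<and> \<Phi> (t - 1) = \<eta> \<and> w = u t"
    using run unfolding lcg_def grad_prox d_def[symmetric] by blast
  define gap where "gap t = d (u t) \<bullet> (u t - v t)" for t
  obtain p where p: "p \<in> X" "\<And>z. z \<in> X \<Longrightarrow> ?\<phi> p \<le> ?\<phi> z"
    using continuous_attains_inf[OF X(2) _ continuous_on_prox] x by blast
  define h where "h t = ?\<phi> (u t) - ?\<phi> p" for t
  have vX: "v t \<in> X" if "1 \<le> t" "enat t \<le> T" for t
    using sep[OF that] by (simp add: losep_def extreme_point_of_def)
  have uX: "u t \<in> X" if "1 \<le> t" "enat t \<le> T" for t
    using that
  proof (induction t rule: nat_induct_at_least)
    case base
    then show ?case using u1 x by simp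
  next
    case (Suc t)
    then have t: "enat t < T" by (metis Suc_ile_eq)
    with Suc have "u t \<in> X" by simp
    moreover have "v t \<in> X" using t Suc by (intro vX) auto
    moreover have "l t \<in> {0..1}" using step[OF _ t] Suc by (simp add: is_arg_min_def)
    ultimately show ?case using step[OF _ t] Suc X(1) by (simp add: convex_alt)
  qed
  have h_nonneg: "0 \<le> h t" if "1 \<le> t" "enat t \<le> T" for t
    using p(2)[OF uX[OF that]] by (simp add: h_def)
  \<comment> \<open>Convexity: the primal gap is at most the linearised gap at the minimiser
    \<open>p\<close>.\<close>
  have h_le: "h t \<le> b" if "\<And>z. z \<in> X \<Longrightarrow> d (u t) \<bullet> (u t - z) \<le> b" for t b
  proof -
    have "h t \<le> d (u t) \<bullet> (u t - p)"
      using pos prox_expand[of g \<beta> x p "u t"]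
      by (simp add: h_def d_def inner_diff_right)
    with that[OF p(1)] show ?thesis by linarith
  qed
  \<comment> \<open>Exact line search is at least as good as every fixed step, so the analysis may
    choose \<open>s\<close> afterwards.\<close>
  have descent: "h (Suc t) \<le> h t - s * gap t + B / 2 * s\<^sup>2"
    if t: "1 \<le> t" "enat t < T" and s: "s \<in> {0..1}" for t s
  proof -
    have "?\<phi> (u (Suc t)) \<le> ?\<phi> ((1 - s) *\<^sub>R u t + s *\<^sub>R v t)"
      using step[OF t] s by (auto simp: is_arg_min_linorder)
    also have "\<dots> = ?\<phi> (u t) + d (u t) \<bullet> (s *\<^sub>R (v t - u t))
        + \<beta> / 2 * (norm (s *\<^sub>R (v t - u t)))\<^sup>2"
      using prox_expand[of g \<beta> x "(1 - s) *\<^sub>R u t + s *\<^sub>R v t" "u t"]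
      by (simp add: d_def algebra_simps)
    also have "\<dots> = ?\<phi> (u t) - s * gap t + \<beta> / 2 * (s\<^sup>2 * (norm (v t - u t))\<^sup>2)"
      unfolding norm_scaleR power_mult_distrib
      by (simp add: gap_def inner_diff_right algebra_simps)
    also have "\<dots> \<le> ?\<phi> (u t) - s * gap t + \<beta> / 2 * (s\<^sup>2 * D\<^sup>2)"
      using pos D(1)[OF vX uX] t
      by (intro add_left_mono mult_left_mono power_mono) auto
    finally show ?thesis by (simp add: h_def B_def algebra_simps)
  qed
  \<comment> \<open>A failed test rules out the first kind of oracle answer. Then \<open>v t\<close>
    is an exact maximiser, and the bound on its gap extends to all of \<open>X\<close>.\<close>
  have gap_le: "d (u t) \<bullet> (u t - z) \<le> \<Phi> (t - 1) / \<alpha>"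
    if t: "1 \<le> t" "enat t \<le> T" and "\<not> \<Phi> (t - 1) / \<alpha> < gap t" and z: "z \<in> X" for t z
  proof -
    have "is_arg_max (\<lambda>z. d (u t) \<bullet> (u t - z)) (\<lambda>z. z \<in> X) (v t)"
      using sep[OF t] that by (simp add: losep_def gap_def)
    then have "d (u t) \<bullet> (u t - z) \<le> gap t"
      using z by (auto simp: is_arg_max_linorder gap_def)
    then show ?thesis using that by linarith
  qed
  \<comment> \<open>The bound in force at call \<open>t\<close> is \<open>\<Phi> (t - 1)\<close>,
    hence the shift of the index.\<close>
  define V where "V t = lcg_potential \<alpha> B \<eta> (h t) (\<Phi> (t - 1))" for t
  have V_decr: "0 < \<Phi> t \<and> V (Suc t) + 1 \<le> V t"
    if t: "1 \<le> t" "enat t < T" and \<Phi>t: "0 < \<Phi> (t - 1)" for t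
  proof (cases "\<Phi> (t - 1) / \<alpha> < gap t")
    case True
    then have "\<Phi> t = \<Phi> (t - 1)" using step[OF t] by (simp add: gap_def)
    then show ?thesis
      using lcg_potential_descent[OF pos(3) B pos(2) \<Phi>t True descent[OF t]] \<Phi>t
      by (simp add: V_def)
  next
    case False
    then have *: "\<Phi> (t - 1) \<noteq> \<eta>" "\<Phi> t = max (\<Phi> (t - 1) / 2) \<eta>"
      using step[OF t] by (auto simp: gap_def)
    have "h t \<le> \<Phi> (t - 1) / \<alpha>"
      using gap_le[OF t(1) _ False] t by (intro h_le) auto
    also have "\<dots> \<le> \<Phi> (t - 1)" using \<Phi>t pos by (simp add: divide_le_eq)
    finally have "h t \<le> \<Phi> (t - 1)" .
    moreover have "h (Suc t) \<le> h t" using descent[OF t, of 0] by simp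
    moreover have "0 \<le> h (Suc t)" using t by (intro h_nonneg) (auto simp: Suc_ile_eq)
    ultimately show ?thesis
      using lcg_potential_halve[OF pos(3) B pos(2) _ _ _ \<Phi>t *(1), of "h (Suc t)" "h t"] * pos
      by (simp add: V_def)
  qed
  \<comment> \<open>Each call before the last lowers \<open>V\<close> by at least one and
    \<open>V\<close> stays nonnegative. The starting index \<open>s\<close> is left free because
    \<open>\<Phi> 0\<close> can be zero, where the potential says nothing.\<close>
  have count: "real t \<le> real s + V s"
    if s: "1 \<le> s" "0 < \<Phi> (s - 1)" and t: "s \<le> t" "enat t \<le> T" for s t
  proof -
    have "0 < \<Phi> (t - 1) \<and> V t + (real t - real s) \<le> V s"
      using t
    proof (induction t rule: nat_induct_at_least)
      case base
      then show ?case using s by simp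
    next
      case (Suc t)
      then have t: "enat t < T" by (metis Suc_ile_eq)
      with Suc V_decr[of t] s(1) show ?case by force
    qed
    moreover from this have "0 \<le> V t"
      unfolding V_def using s t by (intro lcg_potential_nonneg[OF pos(3) B pos(2)] h_nonneg) auto
    ultimately show ?thesis by linarith
  qed
  define G where "G = (SUP z\<in>X. d x \<bullet> (x - z))"
  have "compact ((\<lambda>z. d x \<bullet> (x - z)) ` X)"
    by (intro compact_continuous_image continuous_intros X(2))
  then have bdd: "bdd_above ((\<lambda>z. d x \<bullet> (x - z)) ` X)"
    by (intro bounded_imp_bdd_above compact_imp_bounded)
  have G: "d x \<bullet> (x - z) \<le> G" if "z \<in> X" for z
    unfolding G_def by (rule cSUP_upper[OF that bdd])
  have G_pos: "0 \<le> G" using G[OF x] by simp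
  have G_G0: "G \<le> G0"
    unfolding G_def using x gap0 by (intro cSUP_least) (auto simp: d_def)
  have h1: "h 1 \<le> G" using G u1 by (intro h_le) auto
  have gap1: "gap 1 \<le> G" using G[OF vX[of 1]] u1 T1 by (simp add: gap_def one_enat_def)
  \<comment> \<open>The potential argument starts at call 1, or at call 2 when a first failed test
    has lifted a too small bound to \<open>\<eta>\<close>.\<close>
  have "\<exists>s. 1 \<le> s \<and> s \<le> 2 \<and> enat s \<le> T \<and> 0 < \<Phi> (s - 1) \<and>
    (init = max \<or> \<alpha> = 1 \<longrightarrow> h s \<le> \<Phi> (s - 1) \<and> \<eta> \<le> \<Phi> (s - 1) \<and> \<Phi> (s - 1) \<le> \<eta> + G0)"
  proof (cases "\<eta> \<le> \<Phi> 0")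
    case True
    then show ?thesis using T1 h1 init \<Phi>0 G_G0 G_pos pos
      by (intro exI[of _ 1]) (auto simp: one_enat_def G_def[symmetric])
  next
    case False
    then have \<Phi>0G: "\<Phi> 0 = G" and no_floor: "init \<noteq> max"
      using init \<Phi>0 by (auto simp: G_def)
    show ?thesis
    proof (cases "\<Phi> 0 / \<alpha> < gap 1")
      case True
      \<comment> \<open>The chain \<open>0 \<le> G / \<alpha> < gap 1 \<le> G\<close> makes the
        bound positive, which suffices for termination, and excludes
        \<open>\<alpha> = 1\<close>.\<close>
      have "0 \<le> G / \<alpha>" using G_pos pos by simp
      then have "0 < G" using True[unfolded \<Phi>0G] gap1 by linarith
      moreover have "\<alpha> \<noteq> 1" using True gap1 \<Phi>0G by auto
      ultimately show ?thesis using T1 \<Phi>0G no_floor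
        by (intro exI[of _ 1]) (auto simp: one_enat_def)
    next
      case neg: False
      \<comment> \<open>Stopping at the first call would require \<open>\<Phi> 0 = \<eta>\<close>,
        but here it is smaller.\<close>
      have "T \<noteq> enat 1" using stop[of 1] False by auto
      with T1 have T: "enat 1 < T" by (simp add: one_enat_def)
      then have \<Phi>1: "\<Phi> 1 = \<eta>"
        using step[OF _ T] neg False pos by (simp add: gap_def)
      have "h 2 \<le> h 1" using descent[OF _ T, of 0] by (simp add: numeral_2_eq_2)
      then have "h 2 \<le> \<eta>" using h1 False \<Phi>0G by simp
      with T \<Phi>1 pos G_pos G_G0 show ?thesis
        by (intro exI[of _ 2]) (auto simp: numeral_2_eq_2 Suc_ile_eq)
    qed
  qed
  then obtain s where s: "1 \<le> s" "s \<le> 2" "enat s \<le> T" "0 < \<Phi> (s - 1)"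
    and bound: "init = max \<or> \<alpha> = 1 \<Longrightarrow> h s \<le> \<Phi> (s - 1) \<and> \<eta> \<le> \<Phi> (s - 1) \<and> \<Phi> (s - 1) \<le> \<eta> + G0"
    by blast
  show "T \<noteq> \<infinity>"
  proof
    assume "T = \<infinity>"
    moreover obtain n where "real s + V s < real n" using reals_Archimedean2 by blast
    ultimately show False using count[OF s(1,4), of "max s n"] by auto
  qed
  then obtain t where t: "T = enat t" by auto
  have t1: "1 \<le> t" using T1 t by (simp add: one_enat_def)
  have w: "w = u t" "\<Phi> (t - 1) = \<eta>" "\<not> \<Phi> (t - 1) / \<alpha> < gap t"
    using stop[OF t] by (auto simp: gap_def)
  show "w \<in> X" using uX t1 t w by simp
  show "(g + \<beta> *\<^sub>R (w - x)) \<bullet> (w - z) \<le> \<eta>" if "z \<in> X" for z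
  proof -
    have "d w \<bullet> (w - z) \<le> \<eta> / \<alpha>" using gap_le[OF t1 _ w(3) that] t w by simp
    also have "\<dots> \<le> \<eta>" using pos by (simp add: divide_le_eq)
    finally show ?thesis by (simp add: d_def)
  qed
  show "real (the_enat T)
      \<le> 6 * \<alpha> + 3 + (4 * \<alpha> + 1) * log 2 (1 + G0 / \<eta>) + 14 * \<alpha>\<^sup>2 * (\<beta> * D\<^sup>2) / \<eta>"
    if "init = max \<or> \<alpha> = 1"
  proof -
    note b = bound[OF that]
    have "log 2 (\<Phi> (s - 1) / \<eta>) \<le> log 2 ((\<eta> + G0) / \<eta>)"
      using b pos s G_G0 G_pos by (subst log_le_cancel_iff) (auto simp: divide_right_mono)
    also have "(\<eta> + G0) / \<eta> = 1 + G0 / \<eta>" using pos by (simp add: field_simps)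
    finally have "(4 * \<alpha> + 1) * log 2 (\<Phi> (s - 1) / \<eta>) \<le> (4 * \<alpha> + 1) * log 2 (1 + G0 / \<eta>)"
      using pos by (intro mult_left_mono) auto
    moreover have "V s \<le> 6 * \<alpha> + 1 + (4 * \<alpha> + 1) * log 2 (\<Phi> (s - 1) / \<eta>) + 14 * \<alpha>\<^sup>2 * B / \<eta>"
      unfolding V_def using b by (intro lcg_potential_le[OF pos(3) B pos(2)]) auto
    moreover have "real t \<le> real s + V s" using count[OF s(1,4)] s(3) t by simp
    \<comment> \<open>The possible loss of two calls turns the constant
      \<open>6 * \<alpha> + 1\<close> of the potential into \<open>6 * \<alpha> + 3\<close>.\<close>
    moreover have "real s \<le> 2" using s by simp
    ultimately show ?thesis using t by (simp add: B_def)
  qed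
qed

section \<open>Integration against an independent sample\<close>

context prob_space
begin

context
  fixes F G :: "'a measure" and M1 :: "'b measure" and M2 :: "'c measure" and Y Z
  assumes FG: "indep_set (sets F) (sets G)" "space F = space M" "space G = space M"
    and Y: "Y \<in> measurable F M1" and Z: "Z \<in> measurable G M2"
begin

lemma indep_set_measurable1: "Y \<in> measurable M M1"
  using Y FG indep_setD_ev1[OF FG(1)] by (auto simp: measurable_def)

lemma indep_set_measurable2: "Z \<in> measurable M M2"
  using Z FG indep_setD_ev2[OF FG(1)] by (auto simp: measurable_def)

text \<open>Independence is agreement with the product measure on measurable rectangles, and
  rectangles determine a sigma-finite product measure.\<close>

lemma indep_set_distr_pair:
  "distr M (M1 \<Otimes>\<^sub>M M2) (\<lambda>\<omega>. (Y \<omega>, Z \<omega>)) = distr M M1 Y \<Otimes>\<^sub>M distr M M2 Z"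
proof (rule pair_measure_eqI[symmetric])
  note [measurable] = indep_set_measurable1 indep_set_measurable2
  show "sigma_finite_measure (distr M M1 Y)" "sigma_finite_measure (distr M M2 Z)"
    by (auto intro!: finite_measure.axioms(1) finite_measure_distr
        simp: prob_space_imp_sigma_finite prob_space_distr)
  show "sets (distr M M1 Y \<Otimes>\<^sub>M distr M M2 Z) = sets (distr M (M1 \<Otimes>\<^sub>M M2) (\<lambda>\<omega>. (Y \<omega>, Z \<omega>)))"
    by (simp cong: sets_pair_measure_cong)
  fix A B assume "A \<in> sets (distr M M1 Y)" "B \<in> sets (distr M M2 Z)"
  then have AB[measurable]: "A \<in> sets M1" "B \<in> sets M2" by simp_all
  have "Y -` A \<inter> space M \<in> sets F" "Z -` B \<inter> space M \<in> sets G"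
    using measurable_sets[OF Y AB(1)] measurable_sets[OF Z AB(2)] FG by simp_all
  note indep_setD[OF FG(1) this]
  moreover have "Y -` A \<inter> space M \<inter> (Z -` B \<inter> space M) = (\<lambda>\<omega>. (Y \<omega>, Z \<omega>)) -` (A \<times> B) \<inter> space M"
    by auto
  ultimately show "emeasure (distr M M1 Y) A * emeasure (distr M M2 Z) B
      = emeasure (distr M (M1 \<Otimes>\<^sub>M M2) (\<lambda>\<omega>. (Y \<omega>, Z \<omega>))) (A \<times> B)"
    by (simp add: emeasure_distr emeasure_eq_measure ennreal_mult')
qed

text \<open>This takes the place of conditioning on \<open>F\<close>: by Tonelli the variable
  \<open>Y\<close> may be frozen while the independent \<open>Z\<close> is integrated out.\<close>

lemma nn_integral_indep_set_le:
  assumes h[measurable]: "h \<in> borel_measurable (M1 \<Otimes>\<^sub>M M2)"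
    and le: "\<And>y. y \<in> space M1 \<Longrightarrow> (\<integral>\<^sup>+\<omega>. h (y, Z \<omega>) \<partial>M) \<le> b y"
  shows "(\<integral>\<^sup>+\<omega>. h (Y \<omega>, Z \<omega>) \<partial>M) \<le> (\<integral>\<^sup>+\<omega>. b (Y \<omega>) \<partial>M)"
proof -
  note [measurable] = indep_set_measurable1 indep_set_measurable2
  interpret Z: prob_space "distr M M2 Z" by (rule prob_space_distr) simp
  have "(\<integral>\<^sup>+\<omega>. h (Y \<omega>, Z \<omega>) \<partial>M) = (\<integral>\<^sup>+p. h p \<partial>distr M (M1 \<Otimes>\<^sub>M M2) (\<lambda>\<omega>. (Y \<omega>, Z \<omega>)))"
    by (simp add: nn_integral_distr)
  also have "\<dots> = (\<integral>\<^sup>+y. \<integral>\<^sup>+s. h (y, s) \<partial>distr M M2 Z \<partial>distr M M1 Y)"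
    unfolding indep_set_distr_pair by (rule Z.nn_integral_fst[symmetric]) simp
  also have "\<dots> = (\<integral>\<^sup>+\<omega>. \<integral>\<^sup>+s. h (Y \<omega>, s) \<partial>distr M M2 Z \<partial>M)"
    by (simp add: nn_integral_distr)
  also have "\<dots> = (\<integral>\<^sup>+\<omega>. \<integral>\<^sup>+\<omega>'. h (Y \<omega>, Z \<omega>') \<partial>M \<partial>M)"
  proof (rule nn_integral_cong)
    fix \<omega> assume "\<omega> \<in> space M"
    then have "Y \<omega> \<in> space M1" using indep_set_measurable1 by (rule measurable_space[rotated])
    then show "(\<integral>\<^sup>+s. h (Y \<omega>, s) \<partial>distr M M2 Z) = (\<integral>\<^sup>+\<omega>'. h (Y \<omega>, Z \<omega>') \<partial>M)"
      by (intro nn_integral_distr) simp_all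
  qed
  also have "\<dots> \<le> (\<integral>\<^sup>+\<omega>. b (Y \<omega>) \<partial>M)"
    using measurable_space[OF indep_set_measurable1] by (intro nn_integral_mono le) auto
  finally show ?thesis .
qed

text \<open>The signed version of freezing \<open>Y\<close>, by Fubini; it carries the unbiasedness
  of the oracle over to random query points.\<close>

lemma integral_indep_set_eq_0:
  fixes h :: "'b \<times> 'c \<Rightarrow> real"
  assumes h[measurable]: "h \<in> borel_measurable (M1 \<Otimes>\<^sub>M M2)"
    and int: "integrable M (\<lambda>\<omega>. h (Y \<omega>, Z \<omega>))"
    and zero: "\<And>y. y \<in> space M1 \<Longrightarrow> (\<integral>\<omega>. h (y, Z \<omega>) \<partial>M) = 0"
  shows "(\<integral>\<omega>. h (Y \<omega>, Z \<omega>) \<partial>M) = 0"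
proof -
  note [measurable] = indep_set_measurable1 indep_set_measurable2
  interpret Y: prob_space "distr M M1 Y" by (rule prob_space_distr) simp
  interpret Z: prob_space "distr M M2 Z" by (rule prob_space_distr) simp
  interpret pair_sigma_finite "distr M M1 Y" "distr M M2 Z" ..
  have "(\<integral>\<omega>. h (Y \<omega>, Z \<omega>) \<partial>M) = (\<integral>p. h p \<partial>distr M (M1 \<Otimes>\<^sub>M M2) (\<lambda>\<omega>. (Y \<omega>, Z \<omega>)))"
    by (simp add: integral_distr)
  also have "\<dots> = (\<integral>y. \<integral>s. h (y, s) \<partial>distr M M2 Z \<partial>distr M M1 Y)"
    unfolding indep_set_distr_pair
    using int by (intro integral_fst'[symmetric])
      (simp add: indep_set_distr_pair[symmetric] integrable_distr_eq)
  also have "\<dots> = (\<integral>y. 0 \<partial>distr M M1 Y)"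
  proof (rule Bochner_Integration.integral_cong[OF refl])
    fix y assume "y \<in> space (distr M M1 Y)"
    then have y: "y \<in> space M1" by simp
    then have "(\<integral>s. h (y, s) \<partial>distr M M2 Z) = (\<integral>\<omega>. h (y, Z \<omega>) \<partial>M)"
      by (intro integral_distr) simp_all
    with zero[OF y] show "(\<integral>s. h (y, s) \<partial>distr M M2 Z) = 0" by simp
  qed
  finally show ?thesis by simp
qed

end

end

section \<open>The nonsmooth problem\<close>

lemma norm_diff_le_diameter:
  "compact X \<Longrightarrow> a \<in> X \<Longrightarrow> b \<in> X \<Longrightarrow> norm (a - b) \<le> diameter (X :: 'a::real_normed_vector set)"
  using diameter_bounded_bound[OF compact_imp_bounded, of X a b] by (simp add: dist_norm)

lemma nonsmooth_problem_subgradient: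
  assumes "nonsmooth_problem X P F f f' M" "a \<in> X" "b \<in> X"
  shows "f a + f' a \<bullet> (b - a) \<le> f b" "f b \<le> f a + f' a \<bullet> (b - a) + M * norm (b - a)"
  using assms by (auto simp: nonsmooth_problem_def subdifferential_def norm_minus_commute)

text \<open>Convexity alone does not give continuity on the boundary of \<open>X\<close>. The
  subgradient inequality and the inequality with \<open>M\<close> sandwich \<open>f b - f a\<close>
  between multiples of \<open>norm (b - a)\<close>.\<close>

lemma nonsmooth_problem_continuous:
  fixes X :: "'a::euclidean_space set"
  assumes "nonsmooth_problem X P F f f' M"
  shows "continuous_on X f"
  unfolding continuous_on_def
proof
  fix a assume a: "a \<in> X"
  have M: "0 < M" using assms by (simp add: nonsmooth_problem_def)
  have "((\<lambda>b. (norm (f' a) + M) * norm (b - a)) \<longlongrightarrow> (norm (f' a) + M) * norm (a - a)) (at a within X)"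
    by (intro tendsto_intros)
  then have "((\<lambda>b. (norm (f' a) + M) * norm (b - a)) \<longlongrightarrow> 0) (at a within X)" by simp
  moreover have "norm (f b - f a) \<le> (norm (f' a) + M) * norm (b - a)" if "b \<in> X" for b
  proof -
    have "\<bar>f' a \<bullet> (b - a)\<bar> \<le> norm (f' a) * norm (b - a)" by (rule Cauchy_Schwarz_ineq2)
    moreover have "0 \<le> M * norm (b - a)" using M by simp
    ultimately show ?thesis
      using nonsmooth_problem_subgradient[OF assms a that]
      by (simp add: distrib_right abs_le_iff)
  qed
  then have "\<forall>\<^sub>F b in at a within X. norm (f b - f a) \<le> (norm (f' a) + M) * norm (b - a)"
    by (auto simp: eventually_at_filter)
  ultimately have "((\<lambda>b. f b - f a) \<longlongrightarrow> 0) (at a within X)"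
    by (rule Lim_null_comparison[rotated])
  then show "(f \<longlongrightarrow> f a) (at a within X)" by (rule LIM_zero_cancel)
qed

text \<open>
  \<open>V\<close> is not controlled by \<open>M\<close>: adding a linear function to \<open>f\<close> changes \<open>V\<close> but not \<open>M\<close>.
  This is why \<open>\<epsilon>0\<close> in the theorem has to depend on the problem.
\<close>

lemma nonsmooth_problem_gap_bounded:
  fixes X :: "'a::euclidean_space set"
  assumes "nonsmooth_problem X P F f f' M"
  obtains V where "0 \<le> V" "\<And>z a b. z \<in> X \<Longrightarrow> a \<in> X \<Longrightarrow> b \<in> X \<Longrightarrow> f' z \<bullet> (a - b) \<le> V"
proof -
  have X: "compact X" and M: "0 < M" and D: "0 < diameter X"
    using assms by (auto simp: nonsmooth_problem_def)
  have "compact (f ` X)"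
    by (intro compact_continuous_image nonsmooth_problem_continuous[OF assms] X)
  then obtain K where K: "0 < K" "\<And>a. a \<in> X \<Longrightarrow> \<bar>f a\<bar> \<le> K"
    using compact_imp_bounded[of "f ` X"] by (auto simp: bounded_pos)
  show thesis
  proof
    show "0 \<le> 2 * K + M * diameter X" using K M D by simp
    fix z a b assume *: "z \<in> X" "a \<in> X" "b \<in> X"
    \<comment> \<open>Write \<open>a - b\<close> as \<open>(a - z) - (b - z)\<close>: the
      subgradient inequality bounds the first part from above, the inequality with \<open>M\<close>
      the second from below, and \<open>f z\<close> cancels.\<close>
    have "M * norm (b - z) \<le> M * diameter X"
      using M norm_diff_le_diameter[OF X *(3,1)] by simp
    then show "f' z \<bullet> (a - b) \<le> 2 * K + M * diameter X"
      using nonsmooth_problem_subgradient[OF assms *(1,2)]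
        nonsmooth_problem_subgradient[OF assms *(1,3)] K(2)[OF *(2)] K(2)[OF *(3)]
      by (simp add: inner_diff_right abs_le_iff)
  qed
qed

section \<open>Executions of CALSGD\<close>

locale calsgd_execution =
  fixes X :: "'a::euclidean_space set" and P :: "'s measure" and F f f' M \<sigma> init and \<Omega> :: "'w measure"
    and \<xi> F' \<alpha> and N :: nat and x0 x y z T
  assumes problem: "nonsmooth_problem X P F f f' M"
    and \<sigma>: "0 \<le> \<sigma>" and \<alpha>: "1 \<le> \<alpha>" and N: "1 \<le> N"
    and init: "init \<in> {\<lambda>G \<eta>. G, max}"
    and run: "nonsmooth_calsgd init \<Omega> P \<xi> X F' f' M \<sigma> \<alpha> N x0 x y z T"
begin

definition "\<kappa> = sqrt (\<sigma>\<^sup>2 + M\<^sup>2)"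
definition "D = diameter X"
definition "\<beta> = sqrt (real N) * \<kappa> / D"
definition "\<eta> = D * \<kappa> / sqrt (real N)"

text \<open>\<open>\<F> k\<close> is the information available before sample \<open>k\<close> is
  drawn, and \<open>\<G> k\<close> is that of the sample itself. Both are kept as sigma-algebras on
  \<open>space \<Omega>\<close> so that anything determined by the past can be fed to the
  independence lemmas.\<close>

definition "\<F> k = vimage_algebra (space \<Omega>) (\<lambda>\<omega>. \<lambda>i\<in>{1..<k}. (x i \<omega>, \<xi> i \<omega>)) (Pi\<^sub>M {1..<k} (\<lambda>_. borel \<Otimes>\<^sub>M P))"
definition "\<G> k = vimage_algebra (space \<Omega>) (\<xi> k) P"

definition "\<delta> k \<omega> = F' (z k \<omega>) (\<xi> k \<omega>) - f' (z k \<omega>)"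

lemma X: "convex X" "compact X" and D_pos: "0 < D" and M_pos: "0 < M"
  using problem by (auto simp: nonsmooth_problem_def D_def)

lemma \<kappa>_pos: "0 < \<kappa>" and \<kappa>_sq: "\<kappa>\<^sup>2 = \<sigma>\<^sup>2 + M\<^sup>2"
  using M_pos by (simp_all add: \<kappa>_def add_nonneg_pos)

lemma \<beta>_pos: "0 < \<beta>" and \<eta>_pos: "0 < \<eta>"
  using \<kappa>_pos D_pos N by (simp_all add: \<beta>_def \<eta>_def)

lemma \<beta>_\<eta>: "\<beta> * D\<^sup>2 / \<eta> = real N"
  using \<kappa>_pos D_pos N by (simp add: \<beta>_def \<eta>_def field_simps power2_eq_square)

text \<open>In units of \<open>D * \<kappa> / sqrt (real N)\<close>, the LCG inaccuracy contributes
  1, the initial distance 1/2 and the noise together with \<open>M\<close> another 1.\<close>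

lemma rate_eq: "\<eta> + \<beta> * D\<^sup>2 / (2 * real N) + \<kappa>\<^sup>2 / \<beta> = 5 * D * \<kappa> / (2 * sqrt (real N))"
proof -
  define r where "r = sqrt (real N)"
  have r: "0 < r" "real N = r * r" using N by (simp_all add: r_def)
  show ?thesis using \<kappa>_pos D_pos r(1)
    unfolding \<beta>_def \<eta>_def r_def[symmetric] r(2)
    by (simp add: field_simps power2_eq_square)
qed

lemma norm_diff_D: "a \<in> X \<Longrightarrow> b \<in> X \<Longrightarrow> norm (a - b) \<le> D"
  unfolding D_def by (rule norm_diff_le_diameter[OF X(2)])

lemma prob_space_\<Omega>: "prob_space \<Omega>"
  using run by (simp add: nonsmooth_calsgd_def calsgd_run_def)

sublocale prob_space \<Omega> by (rule prob_space_\<Omega>)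

lemma x0: "x0 \<in> X" and start: "\<And>\<omega>. \<omega> \<in> space \<Omega> \<Longrightarrow> x 0 \<omega> = x0" "\<And>\<omega>. \<omega> \<in> space \<Omega> \<Longrightarrow> y 0 \<omega> = x0"
  using run by (auto simp: nonsmooth_calsgd_def calsgd_run_def)

lemma iteration:
  assumes "k \<in> {1..N}" "\<omega> \<in> space \<Omega>"
  shows z_eq: "z k \<omega> = (1 - 1 / real k) *\<^sub>R y (k - 1) \<omega> + (1 / real k) *\<^sub>R x (k - 1) \<omega>"
    and y_eq: "y k \<omega> = (1 - 1 / real k) *\<^sub>R y (k - 1) \<omega> + (1 / real k) *\<^sub>R x k \<omega>"
    and lcg_run: "lcg init X (prox (F' (z k \<omega>) (\<xi> k \<omega>)) \<beta> (x (k - 1) \<omega>)) (x (k - 1) \<omega>) \<alpha> \<eta> (x k \<omega>) (T k \<omega>)"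
proof -
  have \<beta>: "\<beta> = sqrt (real N * (\<sigma>\<^sup>2 + M\<^sup>2)) / diameter X"
    by (simp add: \<beta>_def \<kappa>_def D_def real_sqrt_mult)
  have \<eta>: "\<eta> = diameter X * sqrt (\<sigma>\<^sup>2 + M\<^sup>2) / sqrt (real N)"
    by (simp add: \<eta>_def \<kappa>_def D_def)
  show "z k \<omega> = (1 - 1 / real k) *\<^sub>R y (k - 1) \<omega> + (1 / real k) *\<^sub>R x (k - 1) \<omega>"
    "y k \<omega> = (1 - 1 / real k) *\<^sub>R y (k - 1) \<omega> + (1 / real k) *\<^sub>R x k \<omega>"
    "lcg init X (prox (F' (z k \<omega>) (\<xi> k \<omega>)) \<beta> (x (k - 1) \<omega>)) (x (k - 1) \<omega>) \<alpha> \<eta> (x k \<omega>) (T k \<omega>)"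
    using run assms unfolding nonsmooth_calsgd_def calsgd_run_def prox_def \<beta> \<eta> by blast+
qed

lemma x_measurable: "k \<in> {1..N} \<Longrightarrow> x k \<in> borel_measurable \<Omega>"
  and T_measurable: "k \<in> {1..N} \<Longrightarrow> T k \<in> measurable \<Omega> (count_space UNIV)"
  and indep: "k \<in> {1..N} \<Longrightarrow> indep_set (sets (\<F> k)) (sets (\<G> k))"
  using run by (auto simp: nonsmooth_calsgd_def calsgd_run_def \<F>_def \<G>_def)

lemma \<xi>_measurable: "k \<in> {1..N} \<Longrightarrow> \<xi> k \<in> measurable \<Omega> P"
  and F'_measurable: "(\<lambda>(z, s). F' z s) \<in> borel_measurable (restrict_space borel X \<Otimes>\<^sub>M P)"
  using run by (auto simp: nonsmooth_calsgd_def sfo_oracle_def)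

lemma sfo:
  assumes "k \<in> {1..N}" "a \<in> X"
  shows "integrable \<Omega> (\<lambda>\<omega>. F' a (\<xi> k \<omega>))" "(\<integral>\<omega>. F' a (\<xi> k \<omega>) \<partial>\<Omega>) = f' a"
    "integrable \<Omega> (\<lambda>\<omega>. (norm (F' a (\<xi> k \<omega>) - f' a))\<^sup>2)"
    "(\<integral>\<omega>. (norm (F' a (\<xi> k \<omega>) - f' a))\<^sup>2 \<partial>\<Omega>) \<le> \<sigma>\<^sup>2"
  using run assms by (auto simp: nonsmooth_calsgd_def sfo_oracle_def dual_norm_eq_norm)

lemma average_in_X:
  assumes "a \<in> X" "b \<in> X" "1 \<le> k"
  shows "(1 - 1 / real k) *\<^sub>R a + (1 / real k) *\<^sub>R b \<in> X"
  using assms X(1) by (simp add: convex_alt)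

lemma lcg_facts:
  assumes k: "k \<in> {1..N}" "\<omega> \<in> space \<Omega>" and x: "x (k - 1) \<omega> \<in> X"
  shows "x k \<omega> \<in> X" (is ?A)
    and "\<And>u. u \<in> X \<Longrightarrow> (F' (z k \<omega>) (\<xi> k \<omega>) + \<beta> *\<^sub>R (x k \<omega> - x (k - 1) \<omega>)) \<bullet> (x k \<omega> - u) \<le> \<eta>"
    and "T k \<omega> \<noteq> \<infinity>"
    and "\<And>G0. init = max \<or> \<alpha> = 1 \<Longrightarrow>
      (\<And>u. u \<in> X \<Longrightarrow> F' (z k \<omega>) (\<xi> k \<omega>) \<bullet> (x (k - 1) \<omega> - u) \<le> G0) \<Longrightarrow>
      real (the_enat (T k \<omega>)) \<le> 6 * \<alpha> + 3 + (4 * \<alpha> + 1) * log 2 (1 + G0 / \<eta>) + 14 * \<alpha>\<^sup>2 * real N"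
proof -
  let ?g = "F' (z k \<omega>) (\<xi> k \<omega>)"
  \<comment> \<open>Some finite bound on the initial gap always exists; it serves for the
    conclusions in which \<open>G0\<close> does not appear.\<close>
  have *: "?g \<bullet> (x (k - 1) \<omega> - u) \<le> norm ?g * D" if "u \<in> X" for u
  proof -
    have "?g \<bullet> (x (k - 1) \<omega> - u) \<le> norm ?g * norm (x (k - 1) \<omega> - u)"
      by (rule norm_cauchy_schwarz)
    also have "\<dots> \<le> norm ?g * D" using norm_diff_D[OF x that] by (intro mult_left_mono) auto
    finally show ?thesis .
  qed
  note lcg = lcg_correct[OF X x norm_diff_D D_pos \<beta>_pos \<eta>_pos \<alpha> init _ lcg_run[OF k]]
  show ?A "T k \<omega> \<noteq> \<infinity>" using lcg(1,3) * by blast+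
  show "(?g + \<beta> *\<^sub>R (x k \<omega> - x (k - 1) \<omega>)) \<bullet> (x k \<omega> - u) \<le> \<eta>" if "u \<in> X" for u
    using lcg(2)[OF _ _ _ that] * by blast
  show "real (the_enat (T k \<omega>)) \<le> 6 * \<alpha> + 3 + (4 * \<alpha> + 1) * log 2 (1 + G0 / \<eta>) + 14 * \<alpha>\<^sup>2 * real N"
    if "init = max \<or> \<alpha> = 1" "\<And>u. u \<in> X \<Longrightarrow> ?g \<bullet> (x (k - 1) \<omega> - u) \<le> G0" for G0
    using lcg(4)[of G0] that \<beta>_\<eta> by (simp add: mult.assoc flip: times_divide_eq_right)
qed

lemma iterates_in_X:
  assumes "\<omega> \<in> space \<Omega>" "k \<le> N"
  shows "x k \<omega> \<in> X \<and> y k \<omega> \<in> X"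
  using assms(2)
proof (induction k)
  case 0
  then show ?case using start[OF assms(1)] x0 by simp
next
  case (Suc k)
  have "x (Suc k) \<omega> \<in> X" using lcg_facts(1)[of "Suc k"] Suc assms by simp
  moreover have "y (Suc k) \<omega> = (1 - 1 / real (Suc k)) *\<^sub>R y k \<omega> + (1 / real (Suc k)) *\<^sub>R x (Suc k) \<omega>"
    using y_eq[of "Suc k" \<omega>] Suc assms by simp
  ultimately show ?case using average_in_X[of "y k \<omega>" "x (Suc k) \<omega>" "Suc k"] Suc by simp
qed

lemma in_X:
  assumes "\<omega> \<in> space \<Omega>"
  shows x_in_X: "k \<le> N \<Longrightarrow> x k \<omega> \<in> X" and y_in_X: "k \<le> N \<Longrightarrow> y k \<omega> \<in> X"
    and z_in_X: "k \<in> {1..N} \<Longrightarrow> z k \<omega> \<in> X"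
proof -
  show "k \<le> N \<Longrightarrow> x k \<omega> \<in> X" "k \<le> N \<Longrightarrow> y k \<omega> \<in> X" using iterates_in_X assms by auto
  assume k: "k \<in> {1..N}"
  then show "z k \<omega> \<in> X" unfolding z_eq[OF k assms]
    using iterates_in_X[OF assms, of "k - 1"] by (intro average_in_X) auto
qed

section \<open>Measurability with respect to the past\<close>

lemma space_\<F>: "space (\<F> k) = space \<Omega>" and space_\<G>: "space (\<G> k) = space \<Omega>"
  by (simp_all add: \<F>_def \<G>_def)

lemma past_measurable:
  assumes "k \<le> N"
  shows "(\<lambda>\<omega>. \<lambda>i\<in>{1..<k}. (x i \<omega>, \<xi> i \<omega>)) \<in> measurable (\<F> k) (Pi\<^sub>M {1..<k} (\<lambda>_. borel \<Otimes>\<^sub>M P))"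
  unfolding \<F>_def using assms measurable_space[OF \<xi>_measurable]
  by (intro measurable_vimage_algebra1) (auto simp: space_PiM space_pair_measure)

lemma \<F>_measurable_sample:
  assumes "i \<in> {1..<k}" "k \<le> N"
  shows "x i \<in> borel_measurable (\<F> k)" "\<xi> i \<in> measurable (\<F> k) P"
proof -
  have "(\<lambda>\<omega>. (\<lambda>i\<in>{1..<k}. (x i \<omega>, \<xi> i \<omega>)) i) \<in> measurable (\<F> k) (borel \<Otimes>\<^sub>M P)"
    using past_measurable[OF assms(2)] assms(1) by (rule measurable_compose[OF _ measurable_component_singleton])
  then have "(\<lambda>\<omega>. (x i \<omega>, \<xi> i \<omega>)) \<in> measurable (\<F> k) (borel \<Otimes>\<^sub>M P)"
    using assms by simp
  from measurable_compose[OF this measurable_fst] measurable_compose[OF this measurable_snd]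
  show "x i \<in> borel_measurable (\<F> k)" "\<xi> i \<in> measurable (\<F> k) P" by simp_all
qed

lemma \<F>_measurable_iterates:
  assumes "i < k" "k \<le> N"
  shows "x i \<in> borel_measurable (\<F> k) \<and> y i \<in> borel_measurable (\<F> k)"
  using assms(1)
proof (induction i)
  case 0
  have "a \<in> borel_measurable (\<F> k)" if "\<And>\<omega>. \<omega> \<in> space \<Omega> \<Longrightarrow> a \<omega> = x0" for a
    by (subst measurable_cong[where g = "\<lambda>_. x0"]) (simp_all add: that space_\<F>)
  with start show ?case by blast
next
  case (Suc i)
  then have [measurable]: "x (Suc i) \<in> borel_measurable (\<F> k)" "y i \<in> borel_measurable (\<F> k)"
    using assms by (auto intro!: \<F>_measurable_sample)
  have "y (Suc i) \<in> borel_measurable (\<F> k) \<longleftrightarrow>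
      (\<lambda>\<omega>. (1 - 1 / real (Suc i)) *\<^sub>R y i \<omega> + (1 / real (Suc i)) *\<^sub>R x (Suc i) \<omega>) \<in> borel_measurable (\<F> k)"
    using Suc.prems assms y_eq[of "Suc i"] by (intro measurable_cong) (auto simp: space_\<F>)
  then show ?case by simp
qed

text \<open>The query point is fixed before its own sample is drawn, so \<open>i = k\<close> is
  included. The target is restricted to \<open>X\<close> because joint measurability of the oracle
  is available only there.\<close>

lemma \<F>_measurable_z:
  assumes "i \<in> {1..k}" "k \<le> N"
  shows "z i \<in> measurable (\<F> k) (restrict_space borel X)"
proof (rule measurable_restrict_space2)
  have i: "i - 1 < k" "i \<in> {1..N}" using assms by auto
  then have [measurable]: "x (i - 1) \<in> borel_measurable (\<F> k)" "y (i - 1) \<in> borel_measurable (\<F> k)"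
    using \<F>_measurable_iterates assms by auto
  have "z i \<in> borel_measurable (\<F> k) \<longleftrightarrow>
      (\<lambda>\<omega>. (1 - 1 / real i) *\<^sub>R y (i - 1) \<omega> + (1 / real i) *\<^sub>R x (i - 1) \<omega>) \<in> borel_measurable (\<F> k)"
    using z_eq[OF i(2)] by (intro measurable_cong) (auto simp: space_\<F>)
  then show "z i \<in> borel_measurable (\<F> k)" by (simp del: One_nat_def)
  show "z i \<in> space (\<F> k) \<rightarrow> X" using z_in_X i by (auto simp: space_\<F>)
qed

lemma \<G>_measurable: "k \<in> {1..N} \<Longrightarrow> \<xi> k \<in> measurable (\<G> k) P"
  unfolding \<G>_def using measurable_space[OF \<xi>_measurable] by (intro measurable_vimage_algebra1) auto

text \<open>The subgradient selection is measurable as the parametric integral of the jointly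
  measurable oracle against the first sample, which exists because \<open>N \<ge> 1\<close>.\<close>

lemma f'_measurable: "f' \<in> borel_measurable (restrict_space borel X)"
proof -
  have 1: "1 \<in> {1..N}" using N by simp
  note [measurable] = \<xi>_measurable[OF 1] F'_measurable
  have "(\<lambda>p. (\<lambda>(z, s). F' z s) (fst p, \<xi> 1 (snd p))) \<in> borel_measurable (restrict_space borel X \<Otimes>\<^sub>M \<Omega>)"
    by (rule measurable_compose[OF _ F'_measurable]) measurable
  then have "(\<lambda>(a, \<omega>). F' a (\<xi> 1 \<omega>)) \<in> borel_measurable (restrict_space borel X \<Otimes>\<^sub>M \<Omega>)"
    by (simp add: split_beta)
  then have "(\<lambda>a. \<integral>\<omega>. F' a (\<xi> 1 \<omega>) \<partial>\<Omega>) \<in> borel_measurable (restrict_space borel X)"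
    by (rule borel_measurable_lebesgue_integral)
  moreover have "f' \<in> borel_measurable (restrict_space borel X) \<longleftrightarrow>
      (\<lambda>a. \<integral>\<omega>. F' a (\<xi> 1 \<omega>) \<partial>\<Omega>) \<in> borel_measurable (restrict_space borel X)"
    by (rule measurable_cong) (simp add: sfo(2)[OF 1] space_restrict_space del: One_nat_def)
  ultimately show ?thesis by simp
qed

lemma error_measurable:
  "(\<lambda>p. F' (fst p) (snd p) - f' (fst p)) \<in> borel_measurable (restrict_space borel X \<Otimes>\<^sub>M P)"
  using borel_measurable_diff[OF F'_measurable measurable_compose[OF measurable_fst f'_measurable]]
  by (simp add: split_beta')

lemma \<F>_measurable_\<delta>:
  assumes "i \<in> {1..<k}" "k \<le> N"
  shows "\<delta> i \<in> borel_measurable (\<F> k)"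
proof -
  have "z i \<in> measurable (\<F> k) (restrict_space borel X)" "\<xi> i \<in> measurable (\<F> k) P"
    using assms by (auto intro!: \<F>_measurable_z \<F>_measurable_sample)
  from measurable_compose[OF measurable_Pair[OF this] error_measurable]
  show ?thesis by (simp add: \<delta>_def[abs_def])
qed

lemma \<delta>_measurable [measurable]:
  assumes k: "k \<in> {1..N}"
  shows "\<delta> k \<in> borel_measurable \<Omega>"
proof -
  have "z k \<in> measurable \<Omega> (restrict_space borel X)"
    by (rule indep_set_measurable1[OF indep[OF k] space_\<F> space_\<G> \<F>_measurable_z \<G>_measurable[OF k]])
      (use k in auto)
  from measurable_compose[OF measurable_Pair[OF this \<xi>_measurable[OF k]] error_measurable]
  show ?thesis by (simp add: \<delta>_def[abs_def])
qed

end

section \<open>Convergence in expectation\<close>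

lemma three_point_identity:
  fixes a b u :: "'a::real_inner"
  shows "2 * ((a - b) \<bullet> (a - u)) = (norm (a - u))\<^sup>2 + (norm (a - b))\<^sup>2 - (norm (b - u))\<^sup>2"
  unfolding power2_norm_eq_inner by (simp add: inner_simps inner_commute)

text \<open>Completing squares: after multiplication by \<open>\<beta>\<close>, the right side minus
  the left is half of \<open>(\<beta> * r - (e + M))\<^sup>2 + (e - M)\<^sup>2\<close>.\<close>

lemma quadratic_absorb:
  fixes e M r \<beta> :: real
  assumes "0 < \<beta>"
  shows "(e + M) * r - \<beta> / 2 * r\<^sup>2 \<le> (e\<^sup>2 + M\<^sup>2) / \<beta>"
proof -
  have "0 \<le> (\<beta> * r - (e + M))\<^sup>2 + (e - M)\<^sup>2" by simp
  then have "((e + M) * r - \<beta> / 2 * r\<^sup>2) * \<beta> \<le> e\<^sup>2 + M\<^sup>2"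
    by (simp add: power2_eq_square algebra_simps)
  then show ?thesis using assms by (simp add: pos_le_divide_eq)
qed

context calsgd_execution
begin

text \<open>With the query point frozen, the variance bound for deterministic points applies
  uniformly and survives integration over the past.\<close>

lemma \<delta>_second_moment:
  assumes k: "k \<in> {1..N}"
  shows "integrable \<Omega> (\<lambda>\<omega>. (norm (\<delta> k \<omega>))\<^sup>2)" and "(\<integral>\<omega>. (norm (\<delta> k \<omega>))\<^sup>2 \<partial>\<Omega>) \<le> \<sigma>\<^sup>2"
proof -
  note [measurable] = \<delta>_measurable[OF k]
  have "(\<integral>\<^sup>+\<omega>. ennreal ((norm (F' (fst (z k \<omega>, \<xi> k \<omega>)) (snd (z k \<omega>, \<xi> k \<omega>)) - f' (fst (z k \<omega>, \<xi> k \<omega>))))\<^sup>2) \<partial>\<Omega>)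
      \<le> (\<integral>\<^sup>+\<omega>. ennreal (\<sigma>\<^sup>2) \<partial>\<Omega>)"
  proof (rule nn_integral_indep_set_le[OF indep[OF k] space_\<F> space_\<G> \<F>_measurable_z \<G>_measurable[OF k]])
    show "k \<in> {1..k}" "k \<le> N" using k by auto
    show "(\<lambda>p. ennreal ((norm (F' (fst p) (snd p) - f' (fst p)))\<^sup>2)) \<in> borel_measurable (restrict_space borel X \<Otimes>\<^sub>M P)"
      using error_measurable by measurable
    fix a assume "a \<in> space (restrict_space borel X)"
    then have a: "a \<in> X" by (simp add: space_restrict_space)
    then show "(\<integral>\<^sup>+\<omega>. ennreal ((norm (F' (fst (a, \<xi> k \<omega>)) (snd (a, \<xi> k \<omega>)) - f' (fst (a, \<xi> k \<omega>))))\<^sup>2) \<partial>\<Omega>) \<le> ennreal (\<sigma>\<^sup>2)"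
      using nn_integral_eq_integral[OF sfo(3)[OF k a]] sfo(4)[OF k a] by (simp add: ennreal_leI)
  qed
  then have le: "(\<integral>\<^sup>+\<omega>. ennreal ((norm (\<delta> k \<omega>))\<^sup>2) \<partial>\<Omega>) \<le> ennreal (\<sigma>\<^sup>2)"
    by (simp add: \<delta>_def emeasure_space_1)
  then show int: "integrable \<Omega> (\<lambda>\<omega>. (norm (\<delta> k \<omega>))\<^sup>2)"
    by (intro integrableI_nonneg) (auto intro: le_less_trans)
  show "(\<integral>\<omega>. (norm (\<delta> k \<omega>))\<^sup>2 \<partial>\<Omega>) \<le> \<sigma>\<^sup>2"
    using le nn_integral_eq_integral[OF int] by simp
qed

text \<open>Both \<open>z k\<close> and \<open>x (k - 1)\<close> belong to the past, so freezing
  them leaves an inner product with a mean-zero vector. The iterate \<open>x k\<close> could not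
  stand here, since it depends on the sample \<open>\<xi> k\<close>.\<close>

lemma \<delta>_orthogonal:
  assumes k: "k \<in> {1..N}" and u: "u \<in> X"
  shows "integrable \<Omega> (\<lambda>\<omega>. \<delta> k \<omega> \<bullet> (u - x (k - 1) \<omega>))" (is ?int)
    and "(\<integral>\<omega>. \<delta> k \<omega> \<bullet> (u - x (k - 1) \<omega>) \<partial>\<Omega>) = 0"
proof -
  define h where "h p = (F' (fst (fst p)) (snd p) - f' (fst (fst p))) \<bullet> (u - snd (fst p))" for p
  have Y: "(\<lambda>\<omega>. (z k \<omega>, x (k - 1) \<omega>)) \<in> measurable (\<F> k) (restrict_space borel X \<Otimes>\<^sub>M borel)"
    using k by (intro measurable_Pair \<F>_measurable_z) (auto simp: \<F>_measurable_iterates)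
  have Y': "(\<lambda>\<omega>. (z k \<omega>, x (k - 1) \<omega>)) \<in> measurable \<Omega> (restrict_space borel X \<Otimes>\<^sub>M borel)"
    by (rule indep_set_measurable1[OF indep[OF k] space_\<F> space_\<G> Y \<G>_measurable[OF k]])
  have "(\<lambda>p. (fst (fst p), snd p)) \<in> measurable ((restrict_space borel X \<Otimes>\<^sub>M borel) \<Otimes>\<^sub>M P) (restrict_space borel X \<Otimes>\<^sub>M P)" by measurable
  from measurable_compose[OF this error_measurable]
  have h: "h \<in> borel_measurable ((restrict_space borel X \<Otimes>\<^sub>M borel) \<Otimes>\<^sub>M P)"
    unfolding h_def[abs_def] by (intro borel_measurable_inner) (simp_all add: borel_measurable_diff)
  have h_eq: "h ((z k \<omega>, x (k - 1) \<omega>), \<xi> k \<omega>) = \<delta> k \<omega> \<bullet> (u - x (k - 1) \<omega>)" for \<omega>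
    by (simp add: h_def \<delta>_def)
  have meas: "(\<lambda>\<omega>. \<delta> k \<omega> \<bullet> (u - x (k - 1) \<omega>)) \<in> borel_measurable \<Omega>"
    using measurable_compose[OF measurable_Pair[OF Y' \<xi>_measurable[OF k]] h]
    by (simp add: h_eq del: One_nat_def)
  show int: ?int
  proof (rule Bochner_Integration.integrable_bound[OF _ meas])
    show "integrable \<Omega> (\<lambda>\<omega>. D * (1 + (norm (\<delta> k \<omega>))\<^sup>2))"
      using \<delta>_second_moment(1)[OF k] by (intro integrable_mult_right integrable_add) auto
    show "AE \<omega> in \<Omega>. norm (\<delta> k \<omega> \<bullet> (u - x (k - 1) \<omega>)) \<le> norm (D * (1 + (norm (\<delta> k \<omega>))\<^sup>2))"
    proof (rule AE_I2)
      fix \<omega> assume \<omega>: "\<omega> \<in> space \<Omega>"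
      let ?n = "norm (\<delta> k \<omega>)"
      have "norm (\<delta> k \<omega> \<bullet> (u - x (k - 1) \<omega>)) \<le> ?n * norm (u - x (k - 1) \<omega>)"
        using Cauchy_Schwarz_ineq2 by simp
      also have "\<dots> \<le> ?n * D"
        using x_in_X[OF \<omega>, of "k - 1"] k u by (intro mult_left_mono norm_diff_D) auto
      \<comment> \<open>Dominating the norm by its square reduces integrability to the second
        moment.\<close>
      also have "?n \<le> 1 + ?n\<^sup>2"
        using sum_power2_ge_zero[of "?n - 1" ?n] zero_le_power2[of "?n - 1"]
        by (simp add: power2_eq_square algebra_simps)
      finally show "norm (\<delta> k \<omega> \<bullet> (u - x (k - 1) \<omega>)) \<le> norm (D * (1 + ?n\<^sup>2))"
        using D_pos by (simp add: mult.commute)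
    qed
  qed
  have "(\<integral>\<omega>. h ((z k \<omega>, x (k - 1) \<omega>), \<xi> k \<omega>) \<partial>\<Omega>) = 0"
  proof (rule integral_indep_set_eq_0[OF indep[OF k] space_\<F> space_\<G> Y \<G>_measurable[OF k] h])
    show "integrable \<Omega> (\<lambda>\<omega>. h ((z k \<omega>, x (k - 1) \<omega>), \<xi> k \<omega>))" unfolding h_eq by (rule int)
    fix p :: "'a \<times> 'a" assume "p \<in> space (restrict_space borel X \<Otimes>\<^sub>M borel)"
    then have p: "fst p \<in> X" by (auto simp: space_pair_measure space_restrict_space)
    have "(\<integral>\<omega>. F' (fst p) (\<xi> k \<omega>) - f' (fst p) \<partial>\<Omega>) = 0"
      using sfo(1,2)[OF k p] by (simp add: prob_space)
    moreover have "integrable \<Omega> (\<lambda>\<omega>. F' (fst p) (\<xi> k \<omega>) - f' (fst p))"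
      using sfo(1)[OF k p] by simp
    ultimately show "(\<integral>\<omega>. h (p, \<xi> k \<omega>) \<partial>\<Omega>) = 0" by (simp add: h_def)
  qed
  then show "(\<integral>\<omega>. \<delta> k \<omega> \<bullet> (u - x (k - 1) \<omega>) \<partial>\<Omega>) = 0" unfolding h_eq .
qed

lemma yN_measurable: "y N \<in> borel_measurable \<Omega>"
proof -
  have N': "N \<in> {1..N}" using N by simp
  have "y (N - 1) \<in> borel_measurable (\<F> N)" using \<F>_measurable_iterates N by simp
  then have [measurable]: "y (N - 1) \<in> borel_measurable \<Omega>"
    by (rule indep_set_measurable1[OF indep[OF N'] space_\<F> space_\<G> _ \<G>_measurable[OF N']])
  note [measurable] = x_measurable[OF N']
  have "y N \<in> borel_measurable \<Omega> \<longleftrightarrow>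
      (\<lambda>\<omega>. (1 - 1 / real N) *\<^sub>R y (N - 1) \<omega> + (1 / real N) *\<^sub>R x N \<omega>) \<in> borel_measurable \<Omega>"
    using y_eq[OF N'] by (intro measurable_cong) auto
  then show ?thesis by (simp del: One_nat_def)
qed

lemma integrable_f_yN: "integrable \<Omega> (\<lambda>\<omega>. f (y N \<omega>))"
proof -
  note cont = nonsmooth_problem_continuous[OF problem]
  have "y N \<in> measurable \<Omega> (restrict_space borel X)"
    using yN_measurable y_in_X by (intro measurable_restrict_space2) auto
  then have meas: "(\<lambda>\<omega>. f (y N \<omega>)) \<in> borel_measurable \<Omega>"
    by (rule measurable_compose[OF _ borel_measurable_continuous_on_restrict[OF cont]])
  have "bounded (f ` X)" by (intro compact_imp_bounded compact_continuous_image cont X)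
  then obtain K where "\<And>a. a \<in> X \<Longrightarrow> norm (f a) \<le> K" by (auto simp: bounded_iff)
  then show ?thesis using y_in_X by (intro integrable_const_bound[OF _ meas]) auto
qed

text \<open>With weights \<open>1 / real k\<close>, multiplying by \<open>k\<close> makes the
  objective values telescope. The accuracy of LCG controls the linear term at \<open>x k\<close>,
  the three-point identity makes the distances telescope, and its quadratic remainder absorbs
  \<open>M\<close> and the noise.\<close>

lemma one_step:
  assumes k: "k \<in> {1..N}" and \<omega>: "\<omega> \<in> space \<Omega>" and u: "u \<in> X"
  shows "real k * f (y k \<omega>) \<le> real (k - 1) * f (y (k - 1) \<omega>) + f u + \<eta>
    + \<beta> / 2 * ((norm (x (k - 1) \<omega> - u))\<^sup>2 - (norm (x k \<omega> - u))\<^sup>2)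
    + ((norm (\<delta> k \<omega>))\<^sup>2 + M\<^sup>2) / \<beta> + \<delta> k \<omega> \<bullet> (u - x (k - 1) \<omega>)"
proof -
  define a b c zz where "a = x k \<omega>" and "b = x (k - 1) \<omega>" and "c = y (k - 1) \<omega>" and "zz = z k \<omega>"
  define s e where "s = f' zz" and "e = \<delta> k \<omega>"
  have g: "F' zz (\<xi> k \<omega>) = s + e" by (simp add: s_def e_def \<delta>_def zz_def)
  have inX: "a \<in> X" "b \<in> X" "c \<in> X" "zz \<in> X" "y k \<omega> \<in> X"
    using x_in_X[OF \<omega>] y_in_X[OF \<omega>] z_in_X[OF \<omega> k] k by (auto simp: a_def b_def c_def zz_def)
  have kpos: "0 < real k" "real (k - 1) = real k - 1" using k by auto
  have yk: "real k *\<^sub>R (y k \<omega> - zz) = real (k - 1) *\<^sub>R (c - zz) + (a - zz)"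
    unfolding y_eq[OF k \<omega>] using kpos
    by (simp add: a_def c_def algebra_simps)
  have "y k \<omega> - zz = (1 / real k) *\<^sub>R (a - b)"
    unfolding y_eq[OF k \<omega>] zz_def z_eq[OF k \<omega>] by (simp add: a_def b_def scaleR_diff_right)
  \<comment> \<open>The points \<open>z k\<close> and \<open>y k\<close> differ only by the weighted
    move from \<open>b\<close> to \<open>a\<close>, so the factor \<open>k\<close> turns the
    \<open>M\<close> term into \<open>M * norm (a - b)\<close>.\<close>
  then have nrm: "real k * norm (zz - y k \<omega>) = norm (a - b)"
    using kpos by (simp add: norm_minus_commute[of zz])
  note sub = nonsmooth_problem_subgradient[OF problem, folded s_def]
  have "real k * f (y k \<omega>) \<le> real k * (f zz + s \<bullet> (y k \<omega> - zz) + M * norm (y k \<omega> - zz))"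
    using sub(2)[OF inX(4,5)] kpos unfolding s_def by (intro mult_left_mono) auto
  also have "\<dots> = real k * f zz + s \<bullet> (real k *\<^sub>R (y k \<omega> - zz)) + M * norm (a - b)"
    unfolding nrm[symmetric] by (simp add: norm_minus_commute algebra_simps)
  also have "\<dots> = real (k - 1) * (f zz + s \<bullet> (c - zz)) + (f zz + s \<bullet> (u - zz)) + s \<bullet> (a - u) + M * norm (a - b)"
    unfolding yk kpos(2) by (simp add: algebra_simps inner_simps)
  also have "\<dots> \<le> real (k - 1) * f c + f u + s \<bullet> (a - u) + M * norm (a - b)"
    using sub(1)[OF inX(4,3)] sub(1)[OF inX(4) u] unfolding s_def
    by (intro add_right_mono add_mono mult_left_mono) auto
  finally have 1: "real k * f (y k \<omega>) \<le> real (k - 1) * f c + f u + s \<bullet> (a - u) + M * norm (a - b)" .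
  have "(s + e + \<beta> *\<^sub>R (a - b)) \<bullet> (a - u) \<le> \<eta>"
    using lcg_facts(2)[OF k \<omega> _ u] inX(2) g by (simp add: a_def b_def zz_def)
  then have 2: "s \<bullet> (a - u) \<le> \<eta> - \<beta> * ((a - b) \<bullet> (a - u)) - e \<bullet> (a - u)"
    by (simp add: inner_add_left)
  have "\<beta> * ((a - b) \<bullet> (a - u)) = \<beta> / 2 * (2 * ((a - b) \<bullet> (a - u)))" by simp
  also have "\<dots> = \<beta> / 2 * ((norm (a - u))\<^sup>2 - (norm (b - u))\<^sup>2) + \<beta> / 2 * (norm (a - b))\<^sup>2"
    unfolding three_point_identity by (simp add: algebra_simps)
  finally have 3: "\<beta> * ((a - b) \<bullet> (a - u))
      = \<beta> / 2 * ((norm (a - u))\<^sup>2 - (norm (b - u))\<^sup>2) + \<beta> / 2 * (norm (a - b))\<^sup>2" .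
  \<comment> \<open>Passing through \<open>b\<close> splits the noise term into a part with mean
    zero and a part that the quadratic remainder can absorb.\<close>
  have 4: "- (e \<bullet> (a - u)) \<le> e \<bullet> (u - b) + norm e * norm (a - b)"
    using Cauchy_Schwarz_ineq2[of e "a - b"] by (simp add: inner_diff_right abs_le_iff)
  have 5: "(norm e + M) * norm (a - b) - \<beta> / 2 * (norm (a - b))\<^sup>2 \<le> ((norm e)\<^sup>2 + M\<^sup>2) / \<beta>"
    by (rule quadratic_absorb[OF \<beta>_pos])
  show ?thesis using 1 2 3 4 5
    unfolding a_def[symmetric] b_def[symmetric] c_def[symmetric] e_def[symmetric]
    by (simp add: algebra_simps)
qed

text \<open>At \<open>n = 0\<close> both sides vanish, so the value of \<open>f\<close> at the
  starting point never enters.\<close>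

lemma all_steps:
  assumes \<omega>: "\<omega> \<in> space \<Omega>" and u: "u \<in> X" and "n \<le> N"
  shows "real n * f (y n \<omega>) \<le> real n * (f u + \<eta>)
    + \<beta> / 2 * ((norm (x 0 \<omega> - u))\<^sup>2 - (norm (x n \<omega> - u))\<^sup>2)
    + (\<Sum>k=1..n. ((norm (\<delta> k \<omega>))\<^sup>2 + M\<^sup>2) / \<beta> + \<delta> k \<omega> \<bullet> (u - x (k - 1) \<omega>))"
  using assms(3)
proof (induction n)
  case (Suc n)
  then show ?case using one_step[OF _ \<omega> u, of "Suc n"] by (simp add: algebra_simps)
qed simp

lemma expected_gap:
  assumes u: "u \<in> X"
  shows "integrable \<Omega> (\<lambda>\<omega>. f (y N \<omega>) - f u)"
    and "(\<integral>\<omega>. f (y N \<omega>) - f u \<partial>\<Omega>) \<le> 5 * D * \<kappa> / (2 * sqrt (real N))"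
proof -
  show int: "integrable \<Omega> (\<lambda>\<omega>. f (y N \<omega>) - f u)" using integrable_f_yN by simp
  \<comment> \<open>\<open>S\<close> collects all random errors; its inner products vanish in
    expectation, leaving the second moments.\<close>
  define S where "S \<omega> = (\<Sum>k=1..N. ((norm (\<delta> k \<omega>))\<^sup>2 + M\<^sup>2) / \<beta> + \<delta> k \<omega> \<bullet> (u - x (k - 1) \<omega>))" for \<omega>
  have intS: "integrable \<Omega> S"
    unfolding S_def[abs_def] using \<delta>_second_moment(1) \<delta>_orthogonal(1)[OF _ u]
    by (intro Bochner_Integration.integrable_sum integrable_add integrable_divide) auto
  have "(\<integral>\<omega>. S \<omega> \<partial>\<Omega>) = (\<Sum>k=1..N. ((\<integral>\<omega>. (norm (\<delta> k \<omega>))\<^sup>2 \<partial>\<Omega>) + M\<^sup>2) / \<beta>)"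
    unfolding S_def using \<delta>_second_moment(1) \<delta>_orthogonal[OF _ u]
    by (subst Bochner_Integration.integral_sum) (auto simp: prob_space intro!: sum.cong)
  also have "\<dots> \<le> (\<Sum>k=1..N. (\<sigma>\<^sup>2 + M\<^sup>2) / \<beta>)"
    using \<delta>_second_moment(2) \<beta>_pos by (intro sum_mono divide_right_mono add_right_mono) auto
  finally have ES: "(\<integral>\<omega>. S \<omega> \<partial>\<Omega>) \<le> real N * (\<kappa>\<^sup>2 / \<beta>)" by (simp add: \<kappa>_sq)
  have "f (y N \<omega>) - f u \<le> \<eta> + \<beta> * D\<^sup>2 / (2 * real N) + S \<omega> / real N" if \<omega>: "\<omega> \<in> space \<Omega>" for \<omega>
  proof -
    have "(norm (x 0 \<omega> - u))\<^sup>2 \<le> D\<^sup>2"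
      using norm_diff_D[OF x_in_X[OF \<omega>] u] by (intro power_mono) auto
    then have "\<beta> / 2 * ((norm (x 0 \<omega> - u))\<^sup>2 - (norm (x N \<omega> - u))\<^sup>2) \<le> \<beta> / 2 * D\<^sup>2"
      using \<beta>_pos zero_le_power2[of "norm (x N \<omega> - u)"] by (intro mult_left_mono) linarith+
    then have "real N * (f (y N \<omega>) - f u) \<le> real N * \<eta> + \<beta> / 2 * D\<^sup>2 + S \<omega>"
      using all_steps[OF \<omega> u order_refl] by (simp add: S_def algebra_simps)
    then have "f (y N \<omega>) - f u \<le> (real N * \<eta> + \<beta> / 2 * D\<^sup>2 + S \<omega>) / real N"
      using N by (simp add: pos_le_divide_eq mult.commute)
    also have "\<dots> = \<eta> + \<beta> * D\<^sup>2 / (2 * real N) + S \<omega> / real N" using N by (simp add: field_simps)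
    finally show ?thesis .
  qed
  then have "(\<integral>\<omega>. f (y N \<omega>) - f u \<partial>\<Omega>) \<le> (\<integral>\<omega>. \<eta> + \<beta> * D\<^sup>2 / (2 * real N) + S \<omega> / real N \<partial>\<Omega>)"
    using int intS by (intro integral_mono) auto
  also have "\<dots> = \<eta> + \<beta> * D\<^sup>2 / (2 * real N) + (\<integral>\<omega>. S \<omega> \<partial>\<Omega>) / real N"
    using intS by (simp add: prob_space)
  also have "\<dots> \<le> \<eta> + \<beta> * D\<^sup>2 / (2 * real N) + \<kappa>\<^sup>2 / \<beta>"
    using ES N by (simp add: pos_divide_le_eq mult.commute)
  finally show "(\<integral>\<omega>. f (y N \<omega>) - f u \<partial>\<Omega>) \<le> 5 * D * \<kappa> / (2 * sqrt (real N))"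
    by (simp add: rate_eq)
qed

end

section \<open>Tail bound for the number of calls\<close>

lemma ereal_of_enat_sum:
  assumes "\<And>k. k \<in> I \<Longrightarrow> T k \<noteq> \<infinity>"
  shows "ereal_of_enat (\<Sum>k\<in>I. T k) = ereal (\<Sum>k\<in>I. real (the_enat (T k)))"
proof -
  have fin: "ereal_of_enat a = ereal (real (the_enat a))" if "a \<noteq> \<infinity>" for a
    using that by (cases a) auto
  have "ereal_of_enat (\<Sum>k\<in>I. T k) = (\<Sum>k\<in>I. ereal_of_enat (T k))"
    by (induction I rule: infinite_finite_induct) (simp_all add: ereal_of_enat_add)
  also have "\<dots> = (\<Sum>k\<in>I. ereal (real (the_enat (T k))))"
    using assms by (intro sum.cong refl fin)
  finally show ?thesis by simp
qed

context calsgd_execution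
begin

text \<open>
  \<open>weight V k\<close> dominates the factor by which the initial bound of the \<open>k\<close>-th LCG call
  can exceed \<open>\<eta>\<close>; the noise enters squared so that its conditional mean is controlled by
  the variance bound.
\<close>

definition "weight V k \<omega> = 1 + V / \<eta> + sqrt (real N) * ((1 + (norm (\<delta> k \<omega>))\<^sup>2 / \<kappa>\<^sup>2) / 2)"

lemma weight_ge_1: "0 \<le> V \<Longrightarrow> 1 \<le> weight V k \<omega>"
  using \<eta>_pos by (simp add: weight_def)

lemma weight_nonneg: "0 \<le> V \<Longrightarrow> 0 \<le> weight V k \<omega>"
  using weight_ge_1[of V k \<omega>] by linarith

text \<open>The first \<open>n\<close> weights are functions of the past of iteration
  \<open>n + 1\<close>. Freezing their product together with the next query point bounds the mean of
  the new factor by \<open>1 + V / \<eta> + sqrt (real N)\<close>, and induction multiplies these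
  bounds.\<close>

lemma nn_integral_prod_weight:
  assumes V: "0 \<le> V" and "n \<le> N"
  shows "(\<integral>\<^sup>+\<omega>. (\<Prod>k=1..n. ennreal (weight V k \<omega>)) \<partial>\<Omega>)
    \<le> ennreal (1 + V / \<eta> + sqrt (real N)) ^ n"
  using assms(2)
proof (induction n)
  case 0
  then show ?case by (simp add: emeasure_space_1)
next
  case (Suc n)
  let ?A = "ennreal (1 + V / \<eta> + sqrt (real N))"
  let ?w = "\<lambda>e. 1 + V / \<eta> + sqrt (real N) * ((1 + (norm e)\<^sup>2 / \<kappa>\<^sup>2) / 2)"
  define k where "k = Suc n"
  have k: "k \<in> {1..N}" using Suc by (simp add: k_def)
  define U where "U \<omega> = (\<Prod>k=1..n. ennreal (weight V k \<omega>))" for \<omega>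
  have "U \<in> borel_measurable (\<F> k)"
    unfolding U_def[abs_def]
  proof (rule borel_measurable_prod_ennreal)
    fix i assume "i \<in> {1..n}"
    then have "\<delta> i \<in> borel_measurable (\<F> k)" using k by (intro \<F>_measurable_\<delta>) (auto simp: k_def)
    then show "(\<lambda>\<omega>. ennreal (weight V i \<omega>)) \<in> borel_measurable (\<F> k)"
      unfolding weight_def by measurable
  qed
  then have Y: "(\<lambda>\<omega>. (U \<omega>, z k \<omega>)) \<in> measurable (\<F> k) (borel \<Otimes>\<^sub>M restrict_space borel X)"
    using k by (intro measurable_Pair \<F>_measurable_z) auto
  define h where "h p = fst (fst p) * ennreal (?w (F' (snd (fst p)) (snd p) - f' (snd (fst p))))" for p
  have "(\<lambda>p. (snd (fst p), snd p)) \<in> measurable ((borel \<Otimes>\<^sub>M restrict_space borel X) \<Otimes>\<^sub>M P) (restrict_space borel X \<Otimes>\<^sub>M P)"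
    by measurable
  from measurable_compose[OF this error_measurable]
  have [measurable]: "(\<lambda>p. F' (snd (fst p)) (snd p) - f' (snd (fst p))) \<in> borel_measurable ((borel \<Otimes>\<^sub>M restrict_space borel X) \<Otimes>\<^sub>M P)"
    by simp
  have h: "h \<in> borel_measurable ((borel \<Otimes>\<^sub>M restrict_space borel X) \<Otimes>\<^sub>M P)"
    unfolding h_def[abs_def] by measurable
  have "(\<integral>\<^sup>+\<omega>. h ((U \<omega>, z k \<omega>), \<xi> k \<omega>) \<partial>\<Omega>) \<le> (\<integral>\<^sup>+\<omega>. (\<lambda>p. fst p * ?A) (U \<omega>, z k \<omega>) \<partial>\<Omega>)"
  proof (rule nn_integral_indep_set_le[OF indep[OF k] space_\<F> space_\<G> Y \<G>_measurable[OF k] h])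
    fix p :: "ennreal \<times> 'a" assume "p \<in> space (borel \<Otimes>\<^sub>M restrict_space borel X)"
    then have p: "snd p \<in> X" by (auto simp: space_pair_measure space_restrict_space)
    define e where "e \<omega> = F' (snd p) (\<xi> k \<omega>) - f' (snd p)" for \<omega>
    have e: "integrable \<Omega> (\<lambda>\<omega>. (norm (e \<omega>))\<^sup>2)" "(\<integral>\<omega>. (norm (e \<omega>))\<^sup>2 \<partial>\<Omega>) \<le> \<kappa>\<^sup>2"
      using sfo(3,4)[OF k p] by (auto simp: e_def \<kappa>_sq intro: add_increasing2)
    have int: "integrable \<Omega> (\<lambda>\<omega>. ?w (e \<omega>))" using e(1) by simp
    have "(\<integral>\<omega>. ?w (e \<omega>) \<partial>\<Omega>) = 1 + V / \<eta> + sqrt (real N) / 2 + sqrt (real N) * ((\<integral>\<omega>. (norm (e \<omega>))\<^sup>2 \<partial>\<Omega>) / \<kappa>\<^sup>2 / 2)"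
      using e(1) by (simp add: prob_space add_divide_distrib algebra_simps)
    \<comment> \<open>The normalised second moment is at most 1, so the two halves of the noise term
      add up to at most \<open>sqrt (real N)\<close>.\<close>
    also have "\<dots> \<le> 1 + V / \<eta> + sqrt (real N) / 2 + sqrt (real N) * (1 / 2)"
      using e(2) \<kappa>_pos by (intro add_left_mono mult_left_mono) (auto simp: divide_le_eq)
    finally have le: "(\<integral>\<omega>. ?w (e \<omega>) \<partial>\<Omega>) \<le> 1 + V / \<eta> + sqrt (real N)" by simp
    have "(\<integral>\<^sup>+\<omega>. h (p, \<xi> k \<omega>) \<partial>\<Omega>) = fst p * (\<integral>\<^sup>+\<omega>. ennreal (?w (e \<omega>)) \<partial>\<Omega>)"
      unfolding h_def e_def[symmetric] fst_conv snd_conv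
      by (intro nn_integral_cmult measurable_compose[OF borel_measurable_integrable[OF int] measurable_ennreal])
    also have "(\<integral>\<^sup>+\<omega>. ennreal (?w (e \<omega>)) \<partial>\<Omega>) = ennreal (\<integral>\<omega>. ?w (e \<omega>) \<partial>\<Omega>)"
      using V \<eta>_pos by (intro nn_integral_eq_integral[OF int] AE_I2) simp
    also have "\<dots> \<le> ?A" using le by (rule ennreal_leI)
    finally show "(\<integral>\<^sup>+\<omega>. h (p, \<xi> k \<omega>) \<partial>\<Omega>) \<le> fst p * ?A" by (simp add: mult_left_mono)
  qed
  moreover have "h ((U \<omega>, z k \<omega>), \<xi> k \<omega>) = (\<Prod>k=1..Suc n. ennreal (weight V k \<omega>))" for \<omega>
    by (simp add: h_def U_def weight_def \<delta>_def k_def)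
  moreover have "(\<integral>\<^sup>+\<omega>. U \<omega> * ?A \<partial>\<Omega>) = (\<integral>\<^sup>+\<omega>. U \<omega> \<partial>\<Omega>) * ?A"
    using measurable_compose[OF indep_set_measurable1[OF indep[OF k] space_\<F> space_\<G> Y \<G>_measurable[OF k]] measurable_fst]
    by (intro nn_integral_multc) simp
  moreover have "(\<integral>\<^sup>+\<omega>. U \<omega> \<partial>\<Omega>) * ?A \<le> ?A ^ n * ?A"
    using Suc unfolding U_def by (intro mult_right_mono) auto
  ultimately show ?case by (simp add: mult.commute)
qed

lemma prod_weight_tail:
  assumes V: "0 \<le> V" and \<Lambda>: "0 < \<Lambda>"
  shows "1 - \<Lambda> \<le> prob {\<omega> \<in> space \<Omega>. (\<Prod>k=1..N. weight V k \<omega>) < (1 + V / \<eta> + sqrt (real N)) ^ N / \<Lambda>}"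
proof -
  let ?W = "\<lambda>\<omega>. \<Prod>k=1..N. weight V k \<omega>" and ?A = "(1 + V / \<eta> + sqrt (real N)) ^ N"
  have meas[measurable]: "?W \<in> borel_measurable \<Omega>"
  proof (rule borel_measurable_prod)
    fix i assume "i \<in> {1..N}"
    note [measurable] = \<delta>_measurable[OF this]
    show "weight V i \<in> borel_measurable \<Omega>" unfolding weight_def[abs_def] by measurable
  qed
  have W: "0 \<le> ?W \<omega>" for \<omega> by (intro prod_nonneg ballI weight_nonneg V)
  have A: "0 < 1 + V / \<eta> + sqrt (real N)" using V \<eta>_pos by (simp add: add_pos_nonneg)
  have "(\<integral>\<^sup>+\<omega>. ennreal (?W \<omega>) \<partial>\<Omega>) = (\<integral>\<^sup>+\<omega>. (\<Prod>k=1..N. ennreal (weight V k \<omega>)) \<partial>\<Omega>)"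
    by (subst prod_ennreal) (simp_all add: weight_nonneg V)
  also have "\<dots> \<le> ennreal ?A"
    using nn_integral_prod_weight[OF V order_refl] A by (simp add: ennreal_power)
  finally have le: "(\<integral>\<^sup>+\<omega>. ennreal (?W \<omega>) \<partial>\<Omega>) \<le> ennreal ?A" .
  then have int: "integrable \<Omega> ?W" using W by (intro integrableI_nonneg[OF meas]) (auto intro: le_less_trans)
  have "(\<integral>\<omega>. ?W \<omega> \<partial>\<Omega>) \<le> ?A"
    using le nn_integral_eq_integral[OF int] W A by simp
  then have "(\<integral>\<omega>. ?W \<omega> \<partial>\<Omega>) / (?A / \<Lambda>) \<le> \<Lambda>"
    using A \<Lambda> by (simp add: divide_le_eq mult.commute)
  moreover have "prob {\<omega> \<in> space \<Omega>. ?A / \<Lambda> \<le> ?W \<omega>} \<le> (\<integral>\<omega>. ?W \<omega> \<partial>\<Omega>) / (?A / \<Lambda>)"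
    using A \<Lambda> W by (intro integral_Markov_inequality_measure[OF int sets.empty_sets]) auto
  moreover have "prob {\<omega> \<in> space \<Omega>. \<not> ?A / \<Lambda> \<le> ?W \<omega>} = 1 - prob {\<omega> \<in> space \<Omega>. ?A / \<Lambda> \<le> ?W \<omega>}"
    by (intro prob_neg) measurable
  ultimately show ?thesis by (simp add: not_le)
qed

text \<open>The gap at the start of an LCG call is at most a deterministic part \<open>V\<close>
  plus the noise norm times \<open>D\<close>; the weight majorises one plus this bound divided by
  \<open>\<eta>\<close>.\<close>

lemma calls_le_log_weight:
  assumes V: "0 \<le> V" "\<And>a b c. a \<in> X \<Longrightarrow> b \<in> X \<Longrightarrow> c \<in> X \<Longrightarrow> f' a \<bullet> (b - c) \<le> V"
    and floor: "init = max \<or> \<alpha> = 1" and k: "k \<in> {1..N}" and \<omega>: "\<omega> \<in> space \<Omega>"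
  shows "real (the_enat (T k \<omega>)) \<le> 6 * \<alpha> + 3 + (4 * \<alpha> + 1) * log 2 (weight V k \<omega>) + 14 * \<alpha>\<^sup>2 * real N"
proof -
  let ?b = "x (k - 1) \<omega>" and ?e = "norm (\<delta> k \<omega>)"
  have b: "?b \<in> X" using k by (intro x_in_X[OF \<omega>]) auto
  have "F' (z k \<omega>) (\<xi> k \<omega>) \<bullet> (?b - u) \<le> V + ?e * D" if u: "u \<in> X" for u
  proof -
    have "\<delta> k \<omega> \<bullet> (?b - u) \<le> ?e * norm (?b - u)" by (rule norm_cauchy_schwarz)
    also have "\<dots> \<le> ?e * D" by (intro mult_left_mono norm_diff_D b u) auto
    finally show ?thesis using V(2)[OF z_in_X[OF \<omega> k] b u]
      by (simp add: \<delta>_def inner_diff_left)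
  qed
  note lcg_facts(4)[OF k \<omega> b floor this]
  moreover have "log 2 (1 + (V + ?e * D) / \<eta>) \<le> log 2 (weight V k \<omega>)"
  proof -
    have "?e * D / \<eta> = sqrt (real N) * (?e / \<kappa>)"
      using D_pos \<kappa>_pos N by (simp add: \<eta>_def field_simps)
    \<comment> \<open>The arithmetic-geometric mean inequality replaces the noise norm by its
      square, as the weight requires.\<close>
    also have "?e / \<kappa> \<le> (1 + (?e / \<kappa>)\<^sup>2) / 2"
      using zero_le_power2[of "?e / \<kappa> - 1"] by (simp add: power2_eq_square algebra_simps)
    finally have "1 + (V + ?e * D) / \<eta> \<le> weight V k \<omega>"
      by (simp add: weight_def add_divide_distrib power_divide mult_left_mono)
    moreover have "0 \<le> (V + ?e * D) / \<eta>" using V(1) D_pos \<eta>_pos by simp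
    ultimately show ?thesis by (subst log_le_cancel_iff) linarith+
  qed
  then have "(4 * \<alpha> + 1) * log 2 (1 + (V + ?e * D) / \<eta>) \<le> (4 * \<alpha> + 1) * log 2 (weight V k \<omega>)"
    using \<alpha> by (intro mult_left_mono) auto
  ultimately show ?thesis by linarith
qed

text \<open>The condition \<open>large\<close> says that \<open>V / \<eta> \<le> real N\<close>.
  Together with \<open>sqrt (real N) \<le> real N\<close> this makes the logarithm of the mean bound
  per factor at most \<open>2 * real N\<close>, so all logarithms together cost only a quadratic
  term in \<open>N\<close>.\<close>

lemma total_calls_tail:
  assumes V: "0 \<le> V" "\<And>a b c. a \<in> X \<Longrightarrow> b \<in> X \<Longrightarrow> c \<in> X \<Longrightarrow> f' a \<bullet> (b - c) \<le> V"
    and floor: "init = max \<or> \<alpha> = 1" and \<Lambda>: "0 < \<Lambda>" "\<Lambda> < 1"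
    and large: "(V / (D * \<kappa>))\<^sup>2 \<le> real N"
    and b: "43 * \<alpha>\<^sup>2 * (real N)\<^sup>2 + 10 * \<alpha>\<^sup>2 * ln (1 / \<Lambda>) \<le> b"
  shows "1 - \<Lambda> \<le> prob {\<omega> \<in> space \<Omega>. ereal_of_enat (\<Sum>k=1..N. T k \<omega>) \<le> ereal b}"
proof -
  let ?A = "1 + V / \<eta> + sqrt (real N)"
  let ?W = "\<lambda>\<omega>. \<Prod>k=1..N. weight V k \<omega>"
  let ?S = "\<lambda>\<omega>. \<Sum>k=1..N. real (the_enat (T k \<omega>))"
  have A: "1 \<le> ?A" using V \<eta>_pos by simp
  have "V / \<eta> = V / (D * \<kappa>) * sqrt (real N)" using D_pos \<kappa>_pos by (simp add: \<eta>_def)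
  also have "\<dots> \<le> sqrt (real N) * sqrt (real N)"
    using large real_le_rsqrt by (intro mult_right_mono) auto
  finally have "V / \<eta> \<le> real N" by simp
  moreover have "sqrt (real N) \<le> real N"
    using N by (intro real_le_lsqrt) (auto simp: power2_eq_square)
  moreover have "ln ?A \<le> V / \<eta> + sqrt (real N)"
    using A ln_add_one_self_le_self[of "V / \<eta> + sqrt (real N)"] V \<eta>_pos by (simp add: add.assoc)
  ultimately have lnA: "real N * ln ?A \<le> real N * (2 * real N)" by (intro mult_left_mono) auto
  have S_le: "?S \<omega> \<le> b" if \<omega>: "\<omega> \<in> space \<Omega>" and W: "?W \<omega> < ?A ^ N / \<Lambda>" for \<omega>
  proof -
    have w: "0 < weight V k \<omega>" for k using weight_ge_1[OF V(1), of k \<omega>] by linarith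
    have S: "(\<Sum>k=1..N. log 2 (weight V k \<omega>)) = ln (?W \<omega>) / ln 2"
      using w by (simp add: log_def sum_divide_distrib ln_prod less_imp_neq[THEN not_sym])
    have "ln (?W \<omega>) \<le> ln (?A ^ N / \<Lambda>)"
      using W w by (intro ln_mono prod_pos) auto
    also have "\<dots> = real N * ln ?A + ln (1 / \<Lambda>)"
      using A \<Lambda> by (simp add: ln_div ln_realpow)
    also have "\<dots> \<le> 2 * (real N)\<^sup>2 + ln (1 / \<Lambda>)" using lnA by (simp add: power2_eq_square)
    finally have L: "(\<Sum>k=1..N. log 2 (weight V k \<omega>)) \<le> (2 * (real N)\<^sup>2 + ln (1 / \<Lambda>)) / ln 2"
      unfolding S by (simp add: divide_right_mono)
    have nn: "0 \<le> 2 * (real N)\<^sup>2 + ln (1 / \<Lambda>)" using \<Lambda> by (intro add_nonneg_nonneg) auto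
    \<comment> \<open>Changing from the natural to the binary logarithm costs at most a factor
      2.\<close>
    have "1 / 2 \<le> ln (2 :: real)" using exp_half_le2 by (subst ln_ge_iff) auto
    then have "(2 * (real N)\<^sup>2 + ln (1 / \<Lambda>)) / ln 2 \<le> (2 * (real N)\<^sup>2 + ln (1 / \<Lambda>)) / (1 / 2)"
      using nn by (intro divide_left_mono) auto
    with L have L2: "(\<Sum>k=1..N. log 2 (weight V k \<omega>)) \<le> 2 * (2 * (real N)\<^sup>2 + ln (1 / \<Lambda>))" by simp
    have \<alpha>2: "\<alpha> \<le> \<alpha>\<^sup>2" "1 \<le> \<alpha>\<^sup>2" using \<alpha> by (simp_all add: self_le_power)
    have N2: "real N \<le> (real N)\<^sup>2" using N by (simp add: power2_eq_square)
    have "?S \<omega> \<le> (\<Sum>k=1..N. 6 * \<alpha> + 3 + (4 * \<alpha> + 1) * log 2 (weight V k \<omega>) + 14 * \<alpha>\<^sup>2 * real N)"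
      by (intro sum_mono calls_le_log_weight V floor \<omega>)
    also have "\<dots> = (6 * \<alpha> + 3) * real N + 14 * \<alpha>\<^sup>2 * (real N)\<^sup>2
        + (4 * \<alpha> + 1) * (\<Sum>k=1..N. log 2 (weight V k \<omega>))"
      by (simp add: sum.distrib sum_distrib_left power2_eq_square algebra_simps)
    \<comment> \<open>Everything is expressed by \<open>\<alpha>\<^sup>2\<close> and the square of
      \<open>N\<close>: 43 is 9 + 14 + 20, and 10 is 5 times the factor 2 from the
      logarithm.\<close>
    also have "\<dots> \<le> (9 * \<alpha>\<^sup>2) * (real N)\<^sup>2 + 14 * \<alpha>\<^sup>2 * (real N)\<^sup>2
        + (5 * \<alpha>\<^sup>2) * (2 * (2 * (real N)\<^sup>2 + ln (1 / \<Lambda>)))"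
      using \<alpha> \<alpha>2 N2 L2 w weight_ge_1[OF V(1)]
      by (intro add_mono mult_mono order_refl sum_nonneg) auto
    also have "\<dots> = 43 * \<alpha>\<^sup>2 * (real N)\<^sup>2 + 10 * \<alpha>\<^sup>2 * ln (1 / \<Lambda>)" by (simp add: algebra_simps)
    finally show ?thesis using b by linarith
  qed
  have [measurable]: "(\<lambda>\<omega>. real (the_enat (T k \<omega>))) \<in> borel_measurable \<Omega>" if "k \<in> {1..N}" for k
    by (rule measurable_compose[OF T_measurable[OF that]]) simp
  \<comment> \<open>Every LCG call terminates, so the extended count is finite everywhere and the
    event can be stated with real numbers.\<close>
  have eq: "{\<omega> \<in> space \<Omega>. ereal_of_enat (\<Sum>k=1..N. T k \<omega>) \<le> ereal b} = {\<omega> \<in> space \<Omega>. ?S \<omega> \<le> b}"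
    using lcg_facts(3) x_in_X by (intro Collect_cong conj_cong refl) (subst ereal_of_enat_sum; force)
  have "1 - \<Lambda> \<le> prob {\<omega> \<in> space \<Omega>. ?W \<omega> < ?A ^ N / \<Lambda>}" by (rule prod_weight_tail[OF V(1) \<Lambda>(1)])
  also have "\<dots> \<le> prob {\<omega> \<in> space \<Omega>. ?S \<omega> \<le> b}"
    by (intro finite_measure_mono) (use S_le in \<open>auto intro: measurable_sets\<close>)
  finally show ?thesis unfolding eq .
qed

end

section \<open>Choice of the iteration limit for a given accuracy\<close>

lemma calls_arithmetic:
  fixes \<sigma> M D \<epsilon> \<Lambda> \<alpha> n :: real
  defines "Q \<equiv> (\<sigma>\<^sup>2 + M\<^sup>2) * D\<^sup>2 / \<epsilon>\<^sup>2" and "R \<equiv> (\<sigma>^4 + M^4) * D^4 / \<epsilon>^4"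
  assumes Q: "4 \<le> Q" and n: "0 \<le> n" "n \<le> 8 * Q" and \<Lambda>: "0 < \<Lambda>" "\<Lambda> < 1"
  shows "43 * \<alpha>\<^sup>2 * n\<^sup>2 + 10 * \<alpha>\<^sup>2 * ln (1 / \<Lambda>)
    \<le> 5504 * \<alpha>\<^sup>2 * (ln ((\<sigma>^4 + M^4) * D^4 / (\<Lambda> * \<epsilon>^4)) + R)"
proof -
  have "(\<sigma>\<^sup>2 + M\<^sup>2)\<^sup>2 \<le> 2 * (\<sigma>^4 + M^4)"
    using zero_le_power2[of "\<sigma>\<^sup>2 - M\<^sup>2"] by (simp add: power2_eq_square power4_eq_xxxx algebra_simps)
  then have "(\<sigma>\<^sup>2 + M\<^sup>2)\<^sup>2 * (D^4 / \<epsilon>^4) \<le> 2 * (\<sigma>^4 + M^4) * (D^4 / \<epsilon>^4)"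
    by (intro mult_right_mono) auto
  moreover have "Q\<^sup>2 = (\<sigma>\<^sup>2 + M\<^sup>2)\<^sup>2 * (D^4 / \<epsilon>^4)"
    by (simp add: Q_def power_mult_distrib power_divide flip: power_mult)
  moreover have "2 * (\<sigma>^4 + M^4) * (D^4 / \<epsilon>^4) = 2 * R"
    unfolding R_def by (simp only: mult.assoc times_divide_eq_right)
  ultimately have QR: "Q\<^sup>2 \<le> 2 * R" by linarith
  have "4\<^sup>2 \<le> Q\<^sup>2" using Q by (intro power_mono) auto
  then have R: "1 \<le> R" using QR by simp
  have ln_split: "ln ((\<sigma>^4 + M^4) * D^4 / (\<Lambda> * \<epsilon>^4)) = ln R + ln (1 / \<Lambda>)"
  proof -
    have "(\<sigma>^4 + M^4) * D^4 / (\<Lambda> * \<epsilon>^4) = R * (1 / \<Lambda>)" by (simp add: R_def)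
    moreover have "ln (R * (1 / \<Lambda>)) = ln R + ln (1 / \<Lambda>)" using R \<Lambda> by (intro ln_mult_pos) auto
    ultimately show ?thesis by (simp only:)
  qed
  \<comment> \<open>From \<open>Q\<^sup>2 \<le> 2 * R\<close> the square of \<open>n\<close> is at
    most \<open>128 * R\<close>, and 43 times 128 is 5504, which also exceeds the factor 10 of the
    logarithm.\<close>
  have "n\<^sup>2 \<le> (8 * Q)\<^sup>2" using n by (intro power_mono) auto
  then have "n\<^sup>2 \<le> 128 * R" using QR by (simp add: power_mult_distrib)
  then have "43 * \<alpha>\<^sup>2 * n\<^sup>2 \<le> 43 * \<alpha>\<^sup>2 * (128 * R)" by (intro mult_left_mono) auto
  moreover have "0 \<le> \<alpha>\<^sup>2 * ln R" "0 \<le> \<alpha>\<^sup>2 * ln (1 / \<Lambda>)" using R \<Lambda> by auto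
  ultimately show ?thesis unfolding ln_split by (simp add: algebra_simps)
qed

text \<open>The constant \<open>C\<close> is chosen before the problem, whereas the threshold
  \<open>\<epsilon>0\<close> may depend on it. Rate and accuracy cover both readings of the initial
  LCG bound. The count of separation calls is restricted to the floored reading or
  \<open>\<alpha> = 1\<close>, where \<open>\<eta>\<close> controls the cost of each LCG
  call.\<close>

theorem corollary15:
  fixes \<alpha> :: real
  assumes "\<alpha> \<ge> 1"
  shows "\<exists>C>0. \<forall>(X :: 'a::euclidean_space set) (P :: 's measure) F f f' M \<sigma> xs.
    nonsmooth_problem X P F f f' M \<and> \<sigma> \<ge> 0 \<and> is_arg_min f (\<lambda>x. x \<in> X) xs \<longrightarrow>
    (\<forall>init\<in>{\<lambda>G \<eta>. G, max}. \<forall>N\<ge>1. \<forall>(\<Omega> :: 'w measure) \<xi> F' x0 x y z T.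
       nonsmooth_calsgd init \<Omega> P \<xi> X F' f' M \<sigma> \<alpha> N x0 x y z T \<longrightarrow>
       integrable \<Omega> (\<lambda>\<omega>. f (y N \<omega>) - f xs) \<and>
       (\<integral>\<omega>. f (y N \<omega>) - f xs \<partial>\<Omega>)
         \<le> 5 * diameter X * sqrt (\<sigma>\<^sup>2 + M\<^sup>2) / (2 * sqrt (real N))) \<and>
    (\<exists>\<epsilon>0>0. \<forall>\<epsilon>. 0 < \<epsilon> \<and> \<epsilon> \<le> \<epsilon>0 \<longrightarrow>
       (\<exists>N\<ge>1. real N \<le> C * ((\<sigma>\<^sup>2 + M\<^sup>2) * (diameter X)\<^sup>2 / \<epsilon>\<^sup>2) \<and>
          (\<forall>init\<in>{\<lambda>G \<eta>. G, max}. \<forall>(\<Omega> :: 'w measure) \<xi> F' x0 x y z T.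
             nonsmooth_calsgd init \<Omega> P \<xi> X F' f' M \<sigma> \<alpha> N x0 x y z T \<longrightarrow>
             stochastic_solution \<Omega> X f xs \<epsilon> (y N) \<and>
             (\<forall>\<Lambda>. 0 < \<Lambda> \<and> \<Lambda> < 1 \<and> (init = max \<or> \<alpha> = 1) \<longrightarrow>
                measure \<Omega> {\<omega> \<in> space \<Omega>. ereal_of_enat (\<Sum>k=1..N. T k \<omega>) \<le>
                    ereal (C * (ln ((\<sigma>^4 + M^4) * (diameter X)^4 / (\<Lambda> * \<epsilon>^4))
                                + (\<sigma>^4 + M^4) * (diameter X)^4 / \<epsilon>^4))}
                  \<ge> 1 - \<Lambda>))))"
proof (rule exI[of _ "5504 * \<alpha>\<^sup>2"], intro conjI allI impI)
  show "0 < 5504 * \<alpha>\<^sup>2" using assms by simp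
next
  fix X :: "'a set" and P :: "'s measure" and F f f' M and \<sigma> :: real and xs
  assume A: "nonsmooth_problem X P F f f' M \<and> \<sigma> \<ge> 0 \<and> is_arg_min f (\<lambda>x. x \<in> X) xs"
  then have problem: "nonsmooth_problem X P F f f' M" and xs: "xs \<in> X"
    by (auto simp: is_arg_min_def)
  have exec: "calsgd_execution X P F f f' M \<sigma> init \<Omega> \<xi> F' \<alpha> N x0 x y z T"
    if "init \<in> {\<lambda>G \<eta>. G, max}" "1 \<le> N" "nonsmooth_calsgd init \<Omega> P \<xi> X F' f' M \<sigma> \<alpha> N x0 x y z T"
    for init and \<Omega> :: "'w measure" and \<xi> F' N x0 x y z T
    using A assms that by unfold_locales auto
  have rate: "integrable \<Omega> (\<lambda>\<omega>. f (y N \<omega>) - f xs) \<and>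
       (\<integral>\<omega>. f (y N \<omega>) - f xs \<partial>\<Omega>) \<le> 5 * diameter X * sqrt (\<sigma>\<^sup>2 + M\<^sup>2) / (2 * sqrt (real N))"
    if h: "init \<in> {\<lambda>G \<eta>. G, max}" "1 \<le> N" "nonsmooth_calsgd init \<Omega> P \<xi> X F' f' M \<sigma> \<alpha> N x0 x y z T"
    for init and \<Omega> :: "'w measure" and \<xi> F' N x0 x y z T
  proof -
    interpret calsgd_execution X P F f f' M \<sigma> init \<Omega> \<xi> F' \<alpha> N x0 x y z T by (rule exec[OF h])
    show ?thesis using expected_gap[OF xs] by (simp add: D_def \<kappa>_def)
  qed
  then show "\<forall>init\<in>{\<lambda>G \<eta>. G, max}. \<forall>N\<ge>1. \<forall>(\<Omega> :: 'w measure) \<xi> F' x0 x y z T.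
       nonsmooth_calsgd init \<Omega> P \<xi> X F' f' M \<sigma> \<alpha> N x0 x y z T \<longrightarrow>
       integrable \<Omega> (\<lambda>\<omega>. f (y N \<omega>) - f xs) \<and>
       (\<integral>\<omega>. f (y N \<omega>) - f xs \<partial>\<Omega>) \<le> 5 * diameter X * sqrt (\<sigma>\<^sup>2 + M\<^sup>2) / (2 * sqrt (real N))"
    by blast
  define \<kappa> where "\<kappa> = sqrt (\<sigma>\<^sup>2 + M\<^sup>2)"
  define D where "D = diameter X"
  have D: "0 < D" and M: "0 < M" using problem by (simp_all add: nonsmooth_problem_def D_def)
  have \<kappa>: "0 < \<kappa>" "\<kappa>\<^sup>2 = \<sigma>\<^sup>2 + M\<^sup>2" using M by (simp_all add: \<kappa>_def add_nonneg_pos)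
  obtain V where V: "0 \<le> V" "\<And>a b c. a \<in> X \<Longrightarrow> b \<in> X \<Longrightarrow> c \<in> X \<Longrightarrow> f' a \<bullet> (b - c) \<le> V"
    using nonsmooth_problem_gap_bounded[OF problem] by blast
  \<comment> \<open>This threshold is equivalent to \<open>q \<ge> 2 + V / (D * \<kappa>)\<close>:
    the 2 absorbs rounding and keeps the logarithm nonnegative, the other summand yields
    \<open>large\<close>.\<close>
  define \<epsilon>0 where "\<epsilon>0 = \<kappa> * D / (2 + V / (D * \<kappa>))"
  have den: "0 < 2 + V / (D * \<kappa>)" using V D \<kappa> by (intro add_pos_nonneg) auto
  have \<epsilon>0: "0 < \<epsilon>0" using den D \<kappa> by (simp add: \<epsilon>0_def)
  show "\<exists>\<epsilon>0>0. \<forall>\<epsilon>. 0 < \<epsilon> \<and> \<epsilon> \<le> \<epsilon>0 \<longrightarrow>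
       (\<exists>N\<ge>1. real N \<le> 5504 * \<alpha>\<^sup>2 * ((\<sigma>\<^sup>2 + M\<^sup>2) * (diameter X)\<^sup>2 / \<epsilon>\<^sup>2) \<and>
          (\<forall>init\<in>{\<lambda>G \<eta>. G, max}. \<forall>(\<Omega> :: 'w measure) \<xi> F' x0 x y z T.
             nonsmooth_calsgd init \<Omega> P \<xi> X F' f' M \<sigma> \<alpha> N x0 x y z T \<longrightarrow>
             stochastic_solution \<Omega> X f xs \<epsilon> (y N) \<and>
             (\<forall>\<Lambda>. 0 < \<Lambda> \<and> \<Lambda> < 1 \<and> (init = max \<or> \<alpha> = 1) \<longrightarrow>
                measure \<Omega> {\<omega> \<in> space \<Omega>. ereal_of_enat (\<Sum>k=1..N. T k \<omega>) \<le>
                    ereal (5504 * \<alpha>\<^sup>2 * (ln ((\<sigma>^4 + M^4) * (diameter X)^4 / (\<Lambda> * \<epsilon>^4))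
                                + (\<sigma>^4 + M^4) * (diameter X)^4 / \<epsilon>^4))}
                  \<ge> 1 - \<Lambda>)))"
  proof (intro exI[of _ \<epsilon>0] conjI allI impI \<epsilon>0)
    fix \<epsilon> assume "0 < \<epsilon> \<and> \<epsilon> \<le> \<epsilon>0"
    then have \<epsilon>: "0 < \<epsilon>" "\<epsilon> \<le> \<epsilon>0" by auto
    define q where "q = \<kappa> * D / \<epsilon>"
    have "q \<ge> \<kappa> * D / \<epsilon>0" unfolding q_def using \<epsilon> \<kappa> D by (intro divide_left_mono) auto
    then have q: "2 + V / (D * \<kappa>) \<le> q" using \<kappa> D by (simp add: \<epsilon>0_def)
    have V': "0 \<le> V / (D * \<kappa>)" using V D \<kappa> by simp
    have Q: "q\<^sup>2 = (\<sigma>\<^sup>2 + M\<^sup>2) * D\<^sup>2 / \<epsilon>\<^sup>2" by (simp add: q_def power_mult_distrib power_divide \<kappa>)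
    have "2\<^sup>2 \<le> q\<^sup>2" using q V' by (intro power_mono) auto
    then have Q4: "4 \<le> q\<^sup>2" by simp
    \<comment> \<open>At the value \<open>25 / 4 * q\<^sup>2\<close> the proven rate equals
      \<open>\<epsilon>\<close> exactly; rounding up adds at most 1, which the bound
      \<open>8 * q\<^sup>2\<close> absorbs.\<close>
    define N where "N = nat \<lceil>25 / 4 * q\<^sup>2\<rceil>"
    have N_ge: "25 / 4 * q\<^sup>2 \<le> real N" unfolding N_def by linarith
    have "real N \<le> 25 / 4 * q\<^sup>2 + 1" unfolding N_def using Q4 by linarith
    then have N_le: "real N \<le> 8 * q\<^sup>2" using Q4 by simp
    have N1: "1 \<le> N" using N_ge Q4 by linarith
    have "(V / (D * \<kappa>))\<^sup>2 \<le> q\<^sup>2" using q V' by (intro power_mono) auto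
    then have large: "(V / (D * \<kappa>))\<^sup>2 \<le> real N" using N_ge Q4 by linarith
    have "5 / 2 * q \<le> sqrt (real N)"
      using N_ge by (intro real_le_rsqrt) (simp add: power_mult_distrib power_divide)
    then have "5 / 2 * (\<kappa> * D) \<le> \<epsilon> * sqrt (real N)"
      using \<epsilon> by (simp add: q_def field_simps)
    then have rate_\<epsilon>: "5 * D * \<kappa> / (2 * sqrt (real N)) \<le> \<epsilon>"
      using N1 by (simp add: pos_divide_le_eq algebra_simps)
    have "1 \<le> \<alpha>\<^sup>2" using assms by simp
    then have "8 * q\<^sup>2 \<le> 5504 * \<alpha>\<^sup>2 * q\<^sup>2" by (intro mult_right_mono) auto
    then have N_bound: "real N \<le> 5504 * \<alpha>\<^sup>2 * ((\<sigma>\<^sup>2 + M\<^sup>2) * (diameter X)\<^sup>2 / \<epsilon>\<^sup>2)"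
      using N_le unfolding Q D_def by linarith
    have solution: "stochastic_solution \<Omega> X f xs \<epsilon> (y N)"
      and calls: "\<And>\<Lambda>. 0 < \<Lambda> \<and> \<Lambda> < 1 \<and> (init = max \<or> \<alpha> = 1) \<Longrightarrow>
         measure \<Omega> {\<omega> \<in> space \<Omega>. ereal_of_enat (\<Sum>k=1..N. T k \<omega>) \<le>
            ereal (5504 * \<alpha>\<^sup>2 * (ln ((\<sigma>^4 + M^4) * (diameter X)^4 / (\<Lambda> * \<epsilon>^4))
                        + (\<sigma>^4 + M^4) * (diameter X)^4 / \<epsilon>^4))} \<ge> 1 - \<Lambda>"
      if h: "init \<in> {\<lambda>G \<eta>. G, max}" "nonsmooth_calsgd init \<Omega> P \<xi> X F' f' M \<sigma> \<alpha> N x0 x y z T"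
      for init and \<Omega> :: "'w measure" and \<xi> F' x0 x y z T
    proof -
      interpret E: calsgd_execution X P F f f' M \<sigma> init \<Omega> \<xi> F' \<alpha> N x0 x y z T
        by (rule exec[OF h(1) N1 h(2)])
      have [simp]: "E.D = D" "E.\<kappa> = \<kappa>" by (simp_all add: E.D_def E.\<kappa>_def D_def \<kappa>_def)
      show "stochastic_solution \<Omega> X f xs \<epsilon> (y N)"
        using E.yN_measurable E.y_in_X E.expected_gap[OF xs] rate_\<epsilon>
        by (auto simp: stochastic_solution_def)
      fix \<Lambda> :: real assume \<Lambda>: "0 < \<Lambda> \<and> \<Lambda> < 1 \<and> (init = max \<or> \<alpha> = 1)"
      show "1 - \<Lambda> \<le> measure \<Omega> {\<omega> \<in> space \<Omega>. ereal_of_enat (\<Sum>k=1..N. T k \<omega>) \<le>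
            ereal (5504 * \<alpha>\<^sup>2 * (ln ((\<sigma>^4 + M^4) * (diameter X)^4 / (\<Lambda> * \<epsilon>^4))
                        + (\<sigma>^4 + M^4) * (diameter X)^4 / \<epsilon>^4))}"
        unfolding D_def[symmetric]
        using \<Lambda> large Q4 N_le
        by (intro E.total_calls_tail[OF V] calls_arithmetic) (auto simp: Q)
    qed
    show "\<exists>N\<ge>1. real N \<le> 5504 * \<alpha>\<^sup>2 * ((\<sigma>\<^sup>2 + M\<^sup>2) * (diameter X)\<^sup>2 / \<epsilon>\<^sup>2) \<and>
          (\<forall>init\<in>{\<lambda>G \<eta>. G, max}. \<forall>(\<Omega> :: 'w measure) \<xi> F' x0 x y z T.
             nonsmooth_calsgd init \<Omega> P \<xi> X F' f' M \<sigma> \<alpha> N x0 x y z T \<longrightarrow>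
             stochastic_solution \<Omega> X f xs \<epsilon> (y N) \<and>
             (\<forall>\<Lambda>. 0 < \<Lambda> \<and> \<Lambda> < 1 \<and> (init = max \<or> \<alpha> = 1) \<longrightarrow>
                measure \<Omega> {\<omega> \<in> space \<Omega>. ereal_of_enat (\<Sum>k=1..N. T k \<omega>) \<le>
                    ereal (5504 * \<alpha>\<^sup>2 * (ln ((\<sigma>^4 + M^4) * (diameter X)^4 / (\<Lambda> * \<epsilon>^4))
                                + (\<sigma>^4 + M^4) * (diameter X)^4 / \<epsilon>^4))}
                  \<ge> 1 - \<Lambda>))"
      using N1 N_bound solution calls by (intro exI[of _ N] conjI ballI allI impI)
  qed
qed

end
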